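(* Let $(\varphi,Q,\xi,\eta,g)$ be a weak contact metric structure on a smooth manifold $M^{2n+1}$, with $Q\xi=\nu\,\xi$. A vector field $X$ on $M$ is a weak contact infinitesimal transformation (weak contact vector field) if and only if there exists a smooth function $f$ on $M$ such that $$QX=-\tfrac12\,\varphi\,\nabla f+\nu\,f\,\xi,$$ where $\nabla f$ is the gradient of $f$ with respect to $g$. Moreover, a weak contact vector field $X$ (with such $f$) is strict if and only if $\xi(f)=0$.
   Context: A weak almost contact structure on a smooth manifold $M^{2n+1}$ is a set $(\varphi,Q,\xi,\eta)$, where $\varphi$ is a $(1,1)$-tensor field, $\xi$ a vector field, $\eta$ a 1-form and $Q$ a nonsingular $(1,1)$-tensor field, such that $\varphi^2=-Q+\eta\otimes Q\xi$, $\eta(\xi)=1$, $Q\xi=\nu\,\xi$ for a positive constant $\nu$, and the distribution $\ker\eta$ is $\varphi$-invariant. It is a weak almost contact metric structure $(\varphi,Q,\xi,\eta,g)$ if $g$ is a Riemannian metric with $g(\varphi X,\varphi Y)=g(X,QY)-\eta(X)\,\eta(QY)$ for all vector fields $X,Y$. It is a weak contact metric structure if, moreover, $d\eta(X,Y)=g(X,\varphi Y)$ for all $X,Y$, where $d\eta(X,Y)=\frac12\{X(\eta(Y))-Y(\eta(X))-\eta([X,Y])\}$. A vector field $X$ on a weak contact metric manifold is a weak contact vector field (weak contact infinitesimal transformation) if there is a smooth function $\sigma:M\to\mathbb R$ with $\mathcal L_X\eta=\sigma\,\eta$ (Lie derivative); it is strict if $\sigma=0$. *)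

theory Defs
  imports "HOL-Analysis.Analysis" "HOL-Library.Function_Algebras"
begin

subsection \<open>Pointwise real vector space structure on function spaces\<close>

instantiation "fun" :: (type, real_vector) real_vector
begin

definition scaleR_fun :: "real \<Rightarrow> ('a \<Rightarrow> 'b) \<Rightarrow> 'a \<Rightarrow> 'b" where
  "scaleR_fun r f = (\<lambda>x. r *\<^sub>R f x)"

instance
  by standard (simp_all add: scaleR_fun_def fun_eq_iff algebra_simps)

end

lemma scaleR_fun_apply [simp]: "(r *\<^sub>R f) x = r *\<^sub>R f x"
  by (simp add: scaleR_fun_def)


subsection \<open>Smooth maps between normed spaces\<close>

text \<open>Meant for open sets and finite-dimensional domains, where Frechet differentiability together
  with all directional derivatives being \<open>C\<^sup>k\<close> is the usual notion of \<open>C\<close> to the \<open>k + 1\<close>.\<close>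

primrec Ck_on :: "nat \<Rightarrow> 'a::real_normed_vector set \<Rightarrow> ('a \<Rightarrow> 'b::real_normed_vector) \<Rightarrow> bool" where
  "Ck_on 0 S f \<longleftrightarrow> continuous_on S f"
| "Ck_on (Suc k) S f \<longleftrightarrow>
     (\<forall>x\<in>S. f differentiable (at x)) \<and> (\<forall>v. Ck_on k S (\<lambda>x. frechet_derivative f (at x) v))"

definition smooth_on :: "'a::real_normed_vector set \<Rightarrow> ('a \<Rightarrow> 'b::real_normed_vector) \<Rightarrow> bool" where
  "smooth_on S f \<longleftrightarrow> (\<forall>k. Ck_on k S f)"


subsection \<open>Smooth manifolds\<close>

text \<open>The manifold is a whole type \<open>'m\<close> carrying its topology (in the theorem of class
  \<^class>\<open>t2_space\<close> and \<^class>\<open>second_countable_topology\<close>), with an atlas of charts \<open>(U, c)\<close> into a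
  Euclidean space \<open>'e\<close>. The atlas need not be maximal: all notions below depend only on the smooth
  structure it generates.\<close>

type_synonym ('m, 'e) chart = "'m set \<times> ('m \<Rightarrow> 'e)"

definition is_chart :: "('m::topological_space, 'e::euclidean_space) chart \<Rightarrow> bool" where
  "is_chart = (\<lambda>(U, c). open U \<and> open (c ` U) \<and> homeomorphism U (c ` U) c (inv_into U c))"

definition smooth_atlas :: "('m::topological_space, 'e::euclidean_space) chart set \<Rightarrow> bool" where
  "smooth_atlas A \<longleftrightarrow>
     (\<forall>C\<in>A. is_chart C) \<and> (\<Union>(U, c)\<in>A. U) = UNIV \<and>
     (\<forall>(U, c)\<in>A. \<forall>(V, d)\<in>A. smooth_on (c ` (U \<inter> V)) (d \<circ> inv_into U c))"

definition smooth_funs :: "('m::topological_space, 'e::euclidean_space) chart set \<Rightarrow> ('m \<Rightarrow> real) set"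
  where "smooth_funs A = {f. \<forall>(U, c)\<in>A. smooth_on (c ` U) (f \<circ> inv_into U c)}"


subsection \<open>Tangent vectors, vector fields and tensor fields\<close>

text \<open>A tangent vector at \<open>p\<close> is a derivation at \<open>p\<close> of the algebra of smooth functions. As all HOL
  functions are total, it is fixed to be \<open>0\<close> on non-smooth functions, so that equality of
  derivations is equality in HOL.\<close>

type_synonym 'm tvec = "('m \<Rightarrow> real) \<Rightarrow> real"

definition tangent_space ::
  "('m::topological_space, 'e::euclidean_space) chart set \<Rightarrow> 'm \<Rightarrow> 'm tvec set" where
  "tangent_space A p = {v.
     (\<forall>f. f \<notin> smooth_funs A \<longrightarrow> v f = 0) \<and>
     (\<forall>f\<in>smooth_funs A. \<forall>h\<in>smooth_funs A. v (f + h) = v f + v h) \<and>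
     (\<forall>r. \<forall>f\<in>smooth_funs A. v (r *\<^sub>R f) = r * v f) \<and>
     (\<forall>f\<in>smooth_funs A. \<forall>h\<in>smooth_funs A. v (f * h) = f p * v h + h p * v f)}"

text \<open>For a vector field \<open>X\<close> and a function \<open>f\<close>, the function \<open>X(f)\<close> is \<open>\<lambda>p. X p f\<close>.\<close>

definition smooth_vector_field ::
  "('m::topological_space, 'e::euclidean_space) chart set \<Rightarrow> ('m \<Rightarrow> 'm tvec) \<Rightarrow> bool" where
  "smooth_vector_field A X \<longleftrightarrow>
     (\<forall>p. X p \<in> tangent_space A p) \<and> (\<forall>f\<in>smooth_funs A. (\<lambda>p. X p f) \<in> smooth_funs A)"

text \<open>On a non-smooth \<open>f\<close> this is \<open>X p 0 - Y p 0 = 0\<close>, as required of a tangent vector.\<close>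

definition lie_bracket :: "('m \<Rightarrow> 'm tvec) \<Rightarrow> ('m \<Rightarrow> 'm tvec) \<Rightarrow> 'm \<Rightarrow> 'm tvec" where
  "lie_bracket X Y = (\<lambda>p f. X p (\<lambda>q. Y q f) - Y p (\<lambda>q. X q f))"

definition linear_map_on :: "'a::real_vector set \<Rightarrow> ('a \<Rightarrow> 'b::real_vector) \<Rightarrow> bool" where
  "linear_map_on S F \<longleftrightarrow>
     (\<forall>v\<in>S. \<forall>w\<in>S. F (v + w) = F v + F w) \<and> (\<forall>r. \<forall>v\<in>S. F (r *\<^sub>R v) = r *\<^sub>R F v)"

text \<open>Tensor fields are families of multilinear maps on the tangent spaces (values outside the
  tangent spaces are irrelevant); smoothness is tested on smooth vector fields.\<close>

definition one_form ::
  "('m::topological_space, 'e::euclidean_space) chart set \<Rightarrow> ('m \<Rightarrow> 'm tvec \<Rightarrow> real) \<Rightarrow> bool" where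
  "one_form A \<eta> \<longleftrightarrow>
     (\<forall>p. linear_map_on (tangent_space A p) (\<eta> p)) \<and>
     (\<forall>X. smooth_vector_field A X \<longrightarrow> (\<lambda>p. \<eta> p (X p)) \<in> smooth_funs A)"

definition tensor_field_11 ::
  "('m::topological_space, 'e::euclidean_space) chart set \<Rightarrow> ('m \<Rightarrow> 'm tvec \<Rightarrow> 'm tvec) \<Rightarrow> bool" where
  "tensor_field_11 A \<phi> \<longleftrightarrow>
     (\<forall>p. linear_map_on (tangent_space A p) (\<phi> p) \<and>
          \<phi> p ` tangent_space A p \<subseteq> tangent_space A p) \<and>
     (\<forall>X. smooth_vector_field A X \<longrightarrow> smooth_vector_field A (\<lambda>p. \<phi> p (X p)))"

definition riemannian_metric ::
  "('m::topological_space, 'e::euclidean_space) chart set \<Rightarrow> ('m \<Rightarrow> 'm tvec \<Rightarrow> 'm tvec \<Rightarrow> real) \<Rightarrow> bool"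
  where
  "riemannian_metric A g \<longleftrightarrow>
     (\<forall>p. \<forall>v\<in>tangent_space A p. linear_map_on (tangent_space A p) (g p v)) \<and>
     (\<forall>p. \<forall>v\<in>tangent_space A p. \<forall>w\<in>tangent_space A p. g p v w = g p w v) \<and>
     (\<forall>p. \<forall>v\<in>tangent_space A p. v \<noteq> 0 \<longrightarrow> 0 < g p v v) \<and>
     (\<forall>X Y. smooth_vector_field A X \<longrightarrow> smooth_vector_field A Y \<longrightarrow>
        (\<lambda>p. g p (X p) (Y p)) \<in> smooth_funs A)"

definition gradient ::
  "('m::topological_space, 'e::euclidean_space) chart set \<Rightarrow> ('m \<Rightarrow> 'm tvec \<Rightarrow> 'm tvec \<Rightarrow> real) \<Rightarrow>
   ('m \<Rightarrow> real) \<Rightarrow> 'm \<Rightarrow> 'm tvec" where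
  "gradient A g f p =
     (THE v. v \<in> tangent_space A p \<and> (\<forall>w\<in>tangent_space A p. g p v w = w f))"

text \<open>Exterior derivative of a 1-form, in the convention with the factor \<open>1/2\<close>.\<close>

definition ext_deriv ::
  "('m \<Rightarrow> 'm tvec \<Rightarrow> real) \<Rightarrow> ('m \<Rightarrow> 'm tvec) \<Rightarrow> ('m \<Rightarrow> 'm tvec) \<Rightarrow> 'm \<Rightarrow> real" where
  "ext_deriv \<eta> X Y p =
     1 / 2 * (X p (\<lambda>q. \<eta> q (Y q)) - Y p (\<lambda>q. \<eta> q (X q)) - \<eta> p (lie_bracket X Y p))"

text \<open>\<open>(L\<^sub>X \<eta>)(Y) = X(\<eta>(Y)) - \<eta>([X, Y])\<close>\<close>

definition lie_deriv_form ::
  "('m \<Rightarrow> 'm tvec) \<Rightarrow> ('m \<Rightarrow> 'm tvec \<Rightarrow> real) \<Rightarrow> ('m \<Rightarrow> 'm tvec) \<Rightarrow> 'm \<Rightarrow> real" where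
  "lie_deriv_form X \<eta> Y p = X p (\<lambda>q. \<eta> q (Y q)) - \<eta> p (lie_bracket X Y p)"


subsection \<open>Weak contact metric structures\<close>

definition weak_almost_contact_structure ::
  "('m::topological_space, 'e::euclidean_space) chart set \<Rightarrow> ('m \<Rightarrow> 'm tvec \<Rightarrow> 'm tvec) \<Rightarrow>
   ('m \<Rightarrow> 'm tvec \<Rightarrow> 'm tvec) \<Rightarrow> ('m \<Rightarrow> 'm tvec) \<Rightarrow> ('m \<Rightarrow> 'm tvec \<Rightarrow> real) \<Rightarrow> bool" where
  "weak_almost_contact_structure A \<phi> Q \<xi> \<eta> \<longleftrightarrow>
     tensor_field_11 A \<phi> \<and> tensor_field_11 A Q \<and> smooth_vector_field A \<xi> \<and> one_form A \<eta> \<and>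
     (\<forall>p. bij_betw (Q p) (tangent_space A p) (tangent_space A p)) \<and>
     (\<forall>p. \<forall>v\<in>tangent_space A p. \<phi> p (\<phi> p v) = - Q p v + \<eta> p v *\<^sub>R Q p (\<xi> p)) \<and>
     (\<forall>p. \<eta> p (\<xi> p) = 1) \<and>
     (\<exists>\<nu>>0. \<forall>p. Q p (\<xi> p) = \<nu> *\<^sub>R \<xi> p) \<and>
     (\<forall>p. \<forall>v\<in>tangent_space A p. \<eta> p v = 0 \<longrightarrow> \<eta> p (\<phi> p v) = 0)"

definition weak_almost_contact_metric_structure ::
  "('m::topological_space, 'e::euclidean_space) chart set \<Rightarrow> ('m \<Rightarrow> 'm tvec \<Rightarrow> 'm tvec) \<Rightarrow>
   ('m \<Rightarrow> 'm tvec \<Rightarrow> 'm tvec) \<Rightarrow> ('m \<Rightarrow> 'm tvec) \<Rightarrow> ('m \<Rightarrow> 'm tvec \<Rightarrow> real) \<Rightarrow>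
   ('m \<Rightarrow> 'm tvec \<Rightarrow> 'm tvec \<Rightarrow> real) \<Rightarrow> bool" where
  "weak_almost_contact_metric_structure A \<phi> Q \<xi> \<eta> g \<longleftrightarrow>
     weak_almost_contact_structure A \<phi> Q \<xi> \<eta> \<and> riemannian_metric A g \<and>
     (\<forall>X Y. smooth_vector_field A X \<longrightarrow> smooth_vector_field A Y \<longrightarrow>
        (\<forall>p. g p (\<phi> p (X p)) (\<phi> p (Y p)) =
             g p (X p) (Q p (Y p)) - \<eta> p (X p) * \<eta> p (Q p (Y p))))"

definition weak_contact_metric_structure ::
  "('m::topological_space, 'e::euclidean_space) chart set \<Rightarrow> ('m \<Rightarrow> 'm tvec \<Rightarrow> 'm tvec) \<Rightarrow>
   ('m \<Rightarrow> 'm tvec \<Rightarrow> 'm tvec) \<Rightarrow> ('m \<Rightarrow> 'm tvec) \<Rightarrow> ('m \<Rightarrow> 'm tvec \<Rightarrow> real) \<Rightarrow>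
   ('m \<Rightarrow> 'm tvec \<Rightarrow> 'm tvec \<Rightarrow> real) \<Rightarrow> bool" where
  "weak_contact_metric_structure A \<phi> Q \<xi> \<eta> g \<longleftrightarrow>
     weak_almost_contact_metric_structure A \<phi> Q \<xi> \<eta> g \<and>
     (\<forall>X Y. smooth_vector_field A X \<longrightarrow> smooth_vector_field A Y \<longrightarrow>
        (\<forall>p. ext_deriv \<eta> X Y p = g p (X p) (\<phi> p (Y p))))"

text \<open>\<open>L\<^sub>X \<eta> = \<sigma> \<eta>\<close> as 1-forms\<close>

definition lie_deriv_eq ::
  "('m::topological_space, 'e::euclidean_space) chart set \<Rightarrow> ('m \<Rightarrow> 'm tvec \<Rightarrow> real) \<Rightarrow>
   ('m \<Rightarrow> 'm tvec) \<Rightarrow> ('m \<Rightarrow> real) \<Rightarrow> bool" where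
  "lie_deriv_eq A \<eta> X \<sigma> \<longleftrightarrow>
     (\<forall>Y. smooth_vector_field A Y \<longrightarrow> (\<forall>p. lie_deriv_form X \<eta> Y p = \<sigma> p * \<eta> p (Y p)))"

definition weak_contact_vector_field ::
  "('m::topological_space, 'e::euclidean_space) chart set \<Rightarrow> ('m \<Rightarrow> 'm tvec \<Rightarrow> real) \<Rightarrow>
   ('m \<Rightarrow> 'm tvec) \<Rightarrow> bool" where
  "weak_contact_vector_field A \<eta> X \<longleftrightarrow>
     smooth_vector_field A X \<and> (\<exists>\<sigma>\<in>smooth_funs A. lie_deriv_eq A \<eta> X \<sigma>)"

definition strict_weak_contact_vector_field ::
  "('m::topological_space, 'e::euclidean_space) chart set \<Rightarrow> ('m \<Rightarrow> 'm tvec \<Rightarrow> real) \<Rightarrow>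
   ('m \<Rightarrow> 'm tvec) \<Rightarrow> bool" where
  "strict_weak_contact_vector_field A \<eta> X \<longleftrightarrow>
     smooth_vector_field A X \<and> lie_deriv_eq A \<eta> X (\<lambda>_. 0)"

end

theory Submission
  imports Defs
begin

text \<open>By \<open>d\<eta>(X, Y) = g(X, \<phi>Y)\<close>, the Lie derivative is \<open>(L\<^sub>X\<eta>)(Y) = 2 g(X, \<phi>Y) + Y(\<eta>(X))\<close>. As \<open>\<phi>\<close> is
  skew-symmetric, this is the inner product of \<open>Y\<close> with \<open>Z = \<nabla>f - 2\<phi>X\<close>, where \<open>f = \<eta>(X)\<close>. Since \<open>\<eta>\<close> is dual to \<open>\<xi>\<close>,
  \<open>L\<^sub>X\<eta> = \<sigma>\<eta>\<close> means \<open>Z = \<sigma>\<xi>\<close>. The kernel of \<open>\<phi>\<close> is spanned by \<open>\<xi>\<close>, so such a \<open>\<sigma>\<close> exists iff \<open>\<phi>Z = 0\<close>, which by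
  \<open>\<phi>\<^sup>2 = -Q + \<nu> \<eta> \<otimes> \<xi>\<close> is the asserted equation, and then \<open>\<sigma> = \<eta>(Z) = \<xi>(f)\<close>. Conversely, applying \<open>\<eta>\<close> to the
  equation for an arbitrary \<open>f\<close> gives \<open>f = \<eta>(X)\<close>.

  Arguing pointwise needs that derivations at a point extend to smooth vector fields, and the existence
  of gradients needs that they form a finite-dimensional space; both follow from Hadamard's
  lemma and bump functions.\<close>

subsection \<open>Calculus of \<open>C\<^sup>k\<close> maps\<close>

text \<open>On an open set differentiability and \<open>frechet_derivative\<close> are local, so the
  directional derivatives of \<open>f\<close> and \<open>g\<close> agree on \<open>S\<close> again
  and the induction applies to them.\<close>

lemma Ck_on_cong:
  assumes "open S" "\<And>x. x \<in> S \<Longrightarrow> f x = g x" "Ck_on k S f"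
  shows "Ck_on k S g"
  using assms(2,3)
proof (induction k arbitrary: f g)
  case 0
  then show ?case by (simp cong: continuous_on_cong)
next
  case (Suc k)
  have d: "f differentiable (at x)" if "x \<in> S" for x
    using Suc.prems that by simp
  have "(g has_derivative frechet_derivative f (at x)) (at x)" if "x \<in> S" for x
    using d[OF that] has_derivative_transform_within_open[OF _ assms(1) that] Suc.prems(1)
    by (metis frechet_derivative_works)
  moreover have "frechet_derivative f (at x) = frechet_derivative g (at x)" if "x \<in> S" for x
    using frechet_derivative_transform_within_open[OF d[OF that] assms(1) that] Suc.prems(1) by blast
  ultimately show ?case
    using Suc.prems(2) Suc.IH[of "\<lambda>x. frechet_derivative f (at x) v" "\<lambda>x. frechet_derivative g (at x) v" for v]
    by (auto simp: differentiable_def)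
qed

text \<open>\<open>Ck_on\<close> refers to the choice operator \<open>frechet_derivative\<close>; by
  uniqueness of derivatives any explicit derivative may stand in for it.\<close>

lemma Ck_on_SucI:
  assumes "open S" "\<And>x. x \<in> S \<Longrightarrow> (f has_derivative f' x) (at x)"
    "\<And>v. Ck_on k S (\<lambda>x. f' x v)"
  shows "Ck_on (Suc k) S f"
proof -
  have "Ck_on k S (\<lambda>x. frechet_derivative f (at x) v)" for v
    by (rule Ck_on_cong[OF assms(1) _ assms(3)[of v]])
      (use frechet_derivative_at[OF assms(2)] in simp)
  then show ?thesis
    using assms(2) by (auto simp: differentiable_def)
qed

lemma Ck_on_Suc_has_derivative:
  "Ck_on (Suc k) S f \<Longrightarrow> x \<in> S \<Longrightarrow> (f has_derivative frechet_derivative f (at x)) (at x)"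
  using frechet_derivative_works by auto

lemma Ck_on_SucD: "Ck_on (Suc k) S f \<Longrightarrow> Ck_on k S f"
proof (induction k arbitrary: f)
  case 0
  then show ?case
    by (auto intro!: continuous_at_imp_continuous_on differentiable_imp_continuous_within)
qed auto

lemma Ck_on_imp_continuous_on: "Ck_on k S f \<Longrightarrow> continuous_on S f"
  by (induction k) (use Ck_on_SucD in auto)

lemma Ck_on_subset: "Ck_on k S f \<Longrightarrow> T \<subseteq> S \<Longrightarrow> Ck_on k T f"
  by (induction k arbitrary: f) (auto intro: continuous_on_subset)

lemma Ck_on_Un:
  "open S \<Longrightarrow> open T \<Longrightarrow> Ck_on k S f \<Longrightarrow> Ck_on k T f \<Longrightarrow> Ck_on k (S \<union> T) f"
  by (induction k arbitrary: f) (auto intro: continuous_on_open_Un)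

lemma Ck_on_const: "open S \<Longrightarrow> Ck_on k S (\<lambda>x. c)"
  by (induction k arbitrary: c) (auto intro!: Ck_on_SucI[where f' = "\<lambda>x v. 0"] simp del: Ck_on.simps(2))

lemma Ck_on_add:
  assumes "open S" "Ck_on k S f" "Ck_on k S g"
  shows "Ck_on k S (\<lambda>x. f x + g x)"
  using assms(2,3)
proof (induction k arbitrary: f g)
  case (Suc k)
  show ?case
    by (rule Ck_on_SucI[OF assms(1) has_derivative_add[OF Ck_on_Suc_has_derivative[OF Suc.prems(1)]
        Ck_on_Suc_has_derivative[OF Suc.prems(2)]]]) (use Suc in auto)
qed (simp add: continuous_on_add)

lemma Ck_on_sum:
  "open S \<Longrightarrow> (\<And>i. i \<in> I \<Longrightarrow> Ck_on k S (f i)) \<Longrightarrow> Ck_on k S (\<lambda>x. \<Sum>i\<in>I. f i x)"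
  by (induction I rule: infinite_finite_induct) (auto intro: Ck_on_const Ck_on_add)

lemma Ck_on_bounded_linear:
  assumes "bounded_linear f" "open S"
  shows "Ck_on k S f"
proof (cases k)
  case 0
  then show ?thesis using linear_continuous_on[OF assms(1)] by simp
next
  case (Suc k)
  show ?thesis
    unfolding Suc by (rule Ck_on_SucI[OF assms(2) bounded_linear_imp_has_derivative[OF assms(1)]])
      (rule Ck_on_const[OF assms(2)])
qed

text \<open>The Leibniz rule writes each directional derivative as a sum of two values of
  \<open>h\<close> on functions of class \<open>Ck_on k\<close>, so the induction closes.\<close>

lemma Ck_on_bounded_bilinear:
  assumes "bounded_bilinear h" "open S" "Ck_on k S f" "Ck_on k S g"
  shows "Ck_on k S (\<lambda>x. h (f x) (g x))"
  using assms(3,4)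
proof (induction k arbitrary: f g)
  case 0
  then show ?case using bounded_bilinear.continuous_on[OF assms(1)] by simp
next
  case (Suc k)
  show ?case
    by (rule Ck_on_SucI[OF assms(2) bounded_bilinear.FDERIV[OF assms(1)
        Ck_on_Suc_has_derivative[OF Suc.prems(1)] Ck_on_Suc_has_derivative[OF Suc.prems(2)]]])
      (use Suc.IH Ck_on_SucD[OF Suc.prems(1)] Ck_on_SucD[OF Suc.prems(2)] Suc.prems
        in \<open>auto intro!: Ck_on_add[OF assms(2)]\<close>)
qed

lemmas Ck_on_mult = Ck_on_bounded_bilinear[OF bounded_bilinear_mult]

lemma Ck_on_compose:
  fixes f :: "'b::euclidean_space \<Rightarrow> 'c::real_normed_vector"
  assumes "open S" "open T" "g ` S \<subseteq> T" "Ck_on k T f" "Ck_on k S g"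
  shows "Ck_on k S (\<lambda>x. f (g x))"
  using assms(4,5)
proof (induction k arbitrary: f)
  case 0
  then show ?case using assms(3) continuous_on_compose2 by auto
next
  case (Suc k)
  let ?f' = "\<lambda>x. frechet_derivative f (at x)" and ?g' = "\<lambda>x. frechet_derivative g (at x)"
  \<comment> \<open>The direction \<open>?g' x v\<close> moves with \<open>x\<close>, while the
    induction hypothesis covers derivatives of \<open>f\<close> in a fixed direction only. Expanding
    in \<open>Basis\<close> leaves finitely many products that it does cover.\<close>
  have "((\<lambda>x. f (g x)) has_derivative (\<lambda>v. \<Sum>b\<in>Basis. (?g' x v \<bullet> b) *\<^sub>R ?f' (g x) b)) (at x)"
    if "x \<in> S" for x
  proof -
    have f': "(f has_derivative ?f' (g x)) (at (g x))"
      using Ck_on_Suc_has_derivative[OF Suc.prems(1)] assms(3) that by blast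
    have "((\<lambda>x. f (g x)) has_derivative (\<lambda>v. ?f' (g x) (?g' x v))) (at x)"
      using has_derivative_compose[OF Ck_on_Suc_has_derivative[OF Suc.prems(2) that] f'] .
    moreover have "?f' (g x) (?g' x v) = (\<Sum>b\<in>Basis. (?g' x v \<bullet> b) *\<^sub>R ?f' (g x) b)" for v
      using linear_sum[OF has_derivative_linear[OF f'], of "\<lambda>b. (?g' x v \<bullet> b) *\<^sub>R b" Basis]
      by (simp add: euclidean_representation linear_cmul[OF has_derivative_linear[OF f']])
    ultimately show ?thesis by simp
  qed
  moreover have "Ck_on k S (\<lambda>x. \<Sum>b\<in>Basis. (?g' x v \<bullet> b) *\<^sub>R ?f' (g x) b)" for v
  proof (rule Ck_on_sum[OF assms(1) Ck_on_bounded_bilinear[OF bounded_bilinear_scaleR assms(1)]])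
    fix b :: 'b
    show "Ck_on k S (\<lambda>x. ?g' x v \<bullet> b)"
      by (rule Ck_on_bounded_bilinear[OF bounded_bilinear_inner assms(1) _ Ck_on_const[OF assms(1)]])
        (use Suc.prems(2) in simp)
    show "Ck_on k S (\<lambda>x. ?f' (g x) b)"
      by (rule Suc.IH[OF _ Ck_on_SucD[OF Suc.prems(2)]]) (use Suc.prems(1) in simp)
  qed
  ultimately show ?case by (rule Ck_on_SucI[OF assms(1)])
qed

section \<open>Closure properties of smooth maps\<close>

lemma smooth_on_imp_Ck_on: "smooth_on S f \<Longrightarrow> Ck_on k S f"
  by (simp add: smooth_on_def)

lemma smooth_on_has_derivative:
  "smooth_on S f \<Longrightarrow> x \<in> S \<Longrightarrow> (f has_derivative frechet_derivative f (at x)) (at x)"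
  by (rule Ck_on_Suc_has_derivative) (rule smooth_on_imp_Ck_on)

lemma smooth_on_frechet_derivative:
  "smooth_on S f \<Longrightarrow> smooth_on S (\<lambda>x. frechet_derivative f (at x) v)"
  unfolding smooth_on_def using Ck_on.simps(2) by blast

lemma smooth_on_cong:
  "open S \<Longrightarrow> (\<And>x. x \<in> S \<Longrightarrow> f x = g x) \<Longrightarrow> smooth_on S f \<Longrightarrow> smooth_on S g"
  unfolding smooth_on_def using Ck_on_cong by blast

lemma smooth_on_subset: "smooth_on S f \<Longrightarrow> T \<subseteq> S \<Longrightarrow> smooth_on T f"
  unfolding smooth_on_def using Ck_on_subset by blast

lemma smooth_on_Un:
  "open S \<Longrightarrow> open T \<Longrightarrow> smooth_on S f \<Longrightarrow> smooth_on T f \<Longrightarrow> smooth_on (S \<union> T) f"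
  unfolding smooth_on_def using Ck_on_Un by blast

lemma smooth_on_const: "open S \<Longrightarrow> smooth_on S (\<lambda>x. c)"
  by (simp add: smooth_on_def Ck_on_const)

lemma smooth_on_add:
  "open S \<Longrightarrow> smooth_on S f \<Longrightarrow> smooth_on S g \<Longrightarrow> smooth_on S (\<lambda>x. f x + g x)"
  by (simp add: smooth_on_def Ck_on_add)

lemma smooth_on_mult:
  fixes f g :: "'a::real_normed_vector \<Rightarrow> 'b::real_normed_algebra"
  shows "open S \<Longrightarrow> smooth_on S f \<Longrightarrow> smooth_on S g \<Longrightarrow> smooth_on S (\<lambda>x. f x * g x)"
  by (simp add: smooth_on_def Ck_on_mult)

lemma smooth_on_inner:
  "open S \<Longrightarrow> smooth_on S f \<Longrightarrow> smooth_on S g \<Longrightarrow> smooth_on S (\<lambda>x. f x \<bullet> g x)"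
  by (simp add: smooth_on_def Ck_on_bounded_bilinear[OF bounded_bilinear_inner])

lemma smooth_on_bounded_linear: "bounded_linear f \<Longrightarrow> open S \<Longrightarrow> smooth_on S f"
  by (simp add: smooth_on_def Ck_on_bounded_linear)

lemma smooth_on_diff_const: "open S \<Longrightarrow> smooth_on S (\<lambda>x. x - a)"
  using smooth_on_add[OF _ smooth_on_bounded_linear[OF bounded_linear_ident] smooth_on_const[of S "- a"]]
  by simp

lemma smooth_on_compose:
  fixes f :: "'b::euclidean_space \<Rightarrow> 'c::real_normed_vector"
  shows "open S \<Longrightarrow> open T \<Longrightarrow> g ` S \<subseteq> T \<Longrightarrow> smooth_on T f \<Longrightarrow> smooth_on S g \<Longrightarrow>
    smooth_on S (\<lambda>x. f (g x))"
  unfolding smooth_on_def using Ck_on_compose by blast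

subsection \<open>Bump functions\<close>

text \<open>For \<open>k = 0\<close> this is the classical smooth function that is flat at 0. The
  power of \<open>t\<close> in the denominator makes the family closed under differentiation up to
  linear combinations.\<close>

definition flat_exp :: "nat \<Rightarrow> real \<Rightarrow> real" where
  "flat_exp k t = (if t \<le> 0 then 0 else exp (- (1 / t)) / t ^ k)"

text \<open>Substituting \<open>inverse t\<close> turns the right-hand limit into that of
  \<open>t ^ k / exp t\<close> at infinity.\<close>

lemma flat_exp_tendsto_0: "(flat_exp k \<longlongrightarrow> 0) (at 0)"
proof -
  have "((\<lambda>t. flat_exp k (inverse t)) \<longlongrightarrow> 0) at_top"
  proof (rule Lim_transform_eventually[OF tendsto_power_div_exp_0])
    show "\<forall>\<^sub>F t in at_top. t ^ k / exp t = flat_exp k (inverse t)"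
      using eventually_gt_at_top[of 0]
      by eventually_elim (simp add: flat_exp_def exp_minus field_simps)
  qed
  then have "(flat_exp k \<longlongrightarrow> 0) (at_right 0)"
    by (simp add: filterlim_at_right_to_top)
  moreover have "(flat_exp k \<longlongrightarrow> 0) (at_left 0)"
    by (rule tendsto_eventually) (auto simp: eventually_at_filter flat_exp_def)
  ultimately show ?thesis by (simp add: filterlim_split_at)
qed

lemma has_real_derivative_flat_exp:
  "(flat_exp k has_real_derivative (flat_exp (k + 2) t - real k * flat_exp (k + 1) t)) (at t)"
proof -
  consider "t < 0" | "t = 0" | "t > 0" by linarith
  then show ?thesis
  proof cases
    case 1
    have "((\<lambda>t. 0) has_real_derivative 0) (at t)" by simp
    then have "(flat_exp k has_real_derivative 0) (at t)"
      by (rule has_field_derivative_transform_within_open[where S = "{..<0}"])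
        (use 1 in \<open>auto simp: flat_exp_def\<close>)
    then show ?thesis using 1 by (simp add: flat_exp_def)
  next
    case 2
    \<comment> \<open>The difference quotient of \<open>flat_exp k\<close> at 0 is
      \<open>flat_exp (Suc k)\<close>, which tends to 0.\<close>
    have "((\<lambda>h. (flat_exp k (0 + h) - flat_exp k 0) / h) \<longlongrightarrow> 0) (at 0)"
      by (rule Lim_transform_eventually[OF flat_exp_tendsto_0[of "Suc k"]])
        (auto simp: flat_exp_def eventually_at_filter)
    then show ?thesis using 2 by (simp add: DERIV_def flat_exp_def)
  next
    case 3
    have "((\<lambda>t. exp (- inverse t) * inverse t ^ k) has_real_derivative
        exp (- inverse t) * (inverse t ^ Suc (Suc 0)) * inverse t ^ k
          - real k * inverse t ^ (k - Suc 0) * (inverse t ^ Suc (Suc 0) * exp (- inverse t))) (at t)"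
      using 3 by (intro DERIV_mult' DERIV_power derivative_eq_intros) auto
    \<comment> \<open>Truncated subtraction spoils the exponent \<open>k - Suc 0\<close> only for
      \<open>k = 0\<close>, where the factor \<open>real k\<close> vanishes.\<close>
    moreover have "real k * inverse t ^ (k - Suc 0) * (inverse t ^ Suc (Suc 0) * exp (- inverse t)) = real k * (inverse t ^ Suc k * exp (- inverse t))"
      by (cases k) auto
    ultimately have "((\<lambda>t. exp (- (1 / t)) / t ^ k) has_real_derivative
        (flat_exp (k + 2) t - real k * flat_exp (k + 1) t)) (at t)"
      using 3 by (simp only:) (simp add: flat_exp_def divide_inverse power_inverse algebra_simps)
    then show ?thesis
      by (rule has_field_derivative_transform_within_open[where S = "{0<..}"])
        (use 3 in \<open>auto simp: flat_exp_def\<close>)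
  qed
qed

lemma Ck_on_flat_exp: "Ck_on j UNIV (flat_exp k)"
proof (induction j arbitrary: k)
  case 0
  show ?case
    using has_real_derivative_flat_exp
    by (auto intro!: continuous_at_imp_continuous_on DERIV_isCont)
next
  case (Suc j)
  show ?case
  proof (rule Ck_on_SucI)
    show "(flat_exp k has_derivative (\<lambda>v. (flat_exp (k + 2) t + (- real k) * flat_exp (k + 1) t) * v)) (at t)" for t
      using has_real_derivative_flat_exp[of k t] by (simp add: has_field_derivative_def)
    show "Ck_on j UNIV (\<lambda>t. (flat_exp (k + 2) t + (- real k) * flat_exp (k + 1) t) * v)" for v
      by (intro Ck_on_mult Ck_on_add Ck_on_const open_UNIV Suc.IH)
  qed simp
qed

lemma smooth_bump_exists:
  fixes a :: "'a::euclidean_space"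
  assumes "0 < r"
  obtains \<psi> :: "'a \<Rightarrow> real" where "smooth_on UNIV \<psi>" "\<psi> a = 1" "\<And>x. x \<notin> ball a r \<Longrightarrow> \<psi> x = 0"
proof
  \<comment> \<open>The argument of the first \<open>flat_exp 0\<close> is positive exactly inside
    the ball; the last factor normalises the value at \<open>a\<close> to 1.\<close>
  let ?\<psi> = "\<lambda>x. flat_exp 0 (r\<^sup>2 + (- 1) * ((x - a) \<bullet> (x - a))) * inverse (flat_exp 0 (r\<^sup>2))"
  have "smooth_on UNIV (\<lambda>x. r\<^sup>2 + (- 1) * ((x - a) \<bullet> (x - a)))"
    by (intro smooth_on_add smooth_on_mult smooth_on_const smooth_on_inner smooth_on_diff_const open_UNIV)
  moreover have "smooth_on UNIV (flat_exp 0)"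
    by (simp add: smooth_on_def Ck_on_flat_exp)
  ultimately have "smooth_on UNIV (\<lambda>x. flat_exp 0 (r\<^sup>2 + (- 1) * ((x - a) \<bullet> (x - a))))"
    by (rule smooth_on_compose[OF open_UNIV open_UNIV subset_UNIV, rotated])
  then show "smooth_on UNIV ?\<psi>"
    by (intro smooth_on_mult smooth_on_const open_UNIV)
  show "?\<psi> a = 1"
    using assms by (simp add: flat_exp_def)
  fix x assume "x \<notin> ball a r"
  then have "r\<^sup>2 \<le> (x - a) \<bullet> (x - a)"
    using assms by (auto simp: dist_norm norm_minus_commute simp flip: power2_norm_eq_inner)
  then show "?\<psi> x = 0" by (simp add: flat_exp_def)
qed

subsection \<open>Hadamard's lemma\<close>

text \<open>Weighted averages of \<open>h\<close> along the segment from \<open>a\<close> to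
  \<open>x\<close>. Each differentiation in \<open>x\<close> brings out one more factor
  \<open>t\<close>, hence the weight \<open>t ^ m\<close>.\<close>

definition ray_integral :: "'a::euclidean_space \<Rightarrow> nat \<Rightarrow> ('a \<Rightarrow> real) \<Rightarrow> 'a \<Rightarrow> real" where
  "ray_integral a m h x = integral (cbox 0 1) (\<lambda>t::real. t ^ m * h (a + t *\<^sub>R (x - a)))"

lemma ray_in_ball:
  fixes a x :: "'a::real_normed_vector"
  assumes "x \<in> ball a R" "t \<in> {0..1::real}"
  shows "a + t *\<^sub>R (x - a) \<in> ball a R"
proof -
  have "norm (t *\<^sub>R (x - a)) \<le> norm (x - a)"
    using assms(2) by (simp add: mult_left_le_one_le)
  then show ?thesis
    using assms(1) by (simp add: dist_norm norm_minus_commute)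
qed

lemma continuous_on_ray:
  fixes a :: "'a::real_normed_vector" and h :: "'a \<Rightarrow> real"
  assumes "continuous_on (ball a R) h"
  shows "continuous_on (ball a R \<times> cbox 0 1) (\<lambda>(x, t::real). t ^ m * h (a + t *\<^sub>R (x - a)) :: real)"
proof -
  have "continuous_on (ball a R \<times> cbox 0 1) (\<lambda>z. h (a + snd z *\<^sub>R (fst z - a)))"
  proof (rule continuous_on_compose2[OF assms])
    show "continuous_on (ball a R \<times> cbox 0 1) (\<lambda>z. a + snd z *\<^sub>R (fst z - a))"
      by (intro continuous_intros)
  qed (use ray_in_ball in \<open>force simp del: mem_ball\<close>)
  then show ?thesis
    unfolding split_beta by (intro continuous_intros)
qed

lemma continuous_on_slice:
  assumes "continuous_on (S \<times> T) (\<lambda>(x, t). F x t)" "x \<in> S"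
  shows "continuous_on T (F x)"
  using continuous_on_compose2[OF assms(1), of T "\<lambda>t. (x, t)"] assms(2)
  by (simp add: continuous_on_Pair image_subset_iff)

text \<open>Differentiation under the integral sign. The result is again a ray integral, so
  \<open>Ck_on_ray_integral\<close> follows by induction for all \<open>m\<close> and
  \<open>h\<close> at once.\<close>

lemma has_derivative_ray_integral:
  fixes a :: "'a::euclidean_space"
  assumes "Ck_on (Suc 0) (ball a R) h" "x \<in> ball a R"
  shows "(ray_integral a m h has_derivative
    (\<lambda>v. ray_integral a (Suc m) (\<lambda>y. frechet_derivative h (at y) v) x)) (at x)"
proof -
  let ?y = "\<lambda>x t. a + t *\<^sub>R (x - a)"
  let ?h' = "\<lambda>x. frechet_derivative h (at x)"
  \<comment> \<open>\<open>leibniz_rule\<close> takes the derivative of the integrand as a jointly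
    continuous family of type \<open>blinfun\<close>. \<open>Blinfun\<close> is meaningful here only
    for \<open>x\<close> in the ball and \<open>t\<close> in the unit interval, as the fact
    \<open>D\<close> records.\<close>
  define D where "D x t = Blinfun (\<lambda>v. t ^ Suc m * ?h' (?y x t) v)" for x and t :: real
  have h': "(h has_derivative ?h' y) (at y)" if "y \<in> ball a R" for y
    using Ck_on_Suc_has_derivative[OF assms(1) that] .
  have D: "blinfun_apply (D x t) = (\<lambda>v. t ^ Suc m * ?h' (?y x t) v)"
    if "x \<in> ball a R" "t \<in> {0..1}" for x t
    unfolding D_def
    by (rule bounded_linear_Blinfun_apply, rule bounded_linear_const_mult,
        rule has_derivative_bounded_linear, rule h', rule ray_in_ball[OF that])
  have cont: "continuous_on (ball a R \<times> cbox 0 1) (\<lambda>(x, t). D x t)"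
  proof (rule continuous_on_blinfun_componentwise)
    fix i :: 'a
    have "continuous_on (ball a R) (\<lambda>y. ?h' y i)"
      using assms(1) by simp
    from continuous_on_ray[OF this, of "Suc m"]
    show "continuous_on (ball a R \<times> cbox 0 1) (\<lambda>z. blinfun_apply (case z of (x, t) \<Rightarrow> D x t) i)"
      by (rule continuous_on_eq) (auto simp: D split_beta)
  qed
  have "((\<lambda>x. integral (cbox 0 1) (\<lambda>t. t ^ m * h (?y x t))) has_derivative
      blinfun_apply (integral (cbox 0 1) (D x))) (at x within ball a R)"
  proof (rule leibniz_rule)
    fix x and t :: real assume xt: "x \<in> ball a R" "t \<in> cbox 0 1"
    then have yt: "?y x t \<in> ball a R" by (simp add: ray_in_ball del: mem_ball)
    have "((\<lambda>x. ?y x t) has_derivative (\<lambda>v. t *\<^sub>R v)) (at x within ball a R)"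
      by (auto intro!: derivative_eq_intros)
    from has_derivative_compose[OF this h'[OF yt]]
    have "((\<lambda>x. h (?y x t)) has_derivative (\<lambda>v. t * ?h' (?y x t) v)) (at x within ball a R)"
      using linear_cmul[OF has_derivative_linear[OF h'[OF yt]]] by simp
    from has_derivative_mult_right[OF this, of "t ^ m"]
    show "((\<lambda>x. t ^ m * h (?y x t)) has_derivative blinfun_apply (D x t)) (at x within ball a R)"
      using xt by (simp add: D mult_ac)
  next
    fix x assume "x \<in> ball a R"
    then show "(\<lambda>t. t ^ m * h (?y x t)) integrable_on cbox 0 1"
      by (intro integrable_continuous
          continuous_on_slice[OF continuous_on_ray[OF Ck_on_imp_continuous_on[OF assms(1)]]])
  qed (use cont assms(2) in auto)
  moreover have "blinfun_apply (integral (cbox 0 1) (D x)) v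
      = ray_integral a (Suc m) (\<lambda>y. ?h' y v) x" for v
  proof -
    have "D x integrable_on cbox 0 1"
      by (intro integrable_continuous continuous_on_slice[OF cont assms(2)])
    then have "blinfun_apply (integral (cbox 0 1) (D x)) v
        = integral (cbox 0 1) (\<lambda>t. blinfun_apply (D x t) v)"
      by (rule blinfun_apply_integral)
    then show ?thesis
      unfolding ray_integral_def using D[OF assms(2)] by (simp only:) (intro integral_cong, simp)
  qed
  then have "blinfun_apply (integral (cbox 0 1) (D x)) = (\<lambda>v. ray_integral a (Suc m) (\<lambda>y. ?h' y v) x)"
    by (rule ext)
  ultimately show ?thesis
    by (simp only: at_within_open[OF assms(2) open_ball]) (simp only: ray_integral_def[abs_def])
qed

lemma Ck_on_ray_integral:
  fixes a :: "'a::euclidean_space"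
  assumes "Ck_on k (ball a R) h"
  shows "Ck_on k (ball a R) (ray_integral a m h)"
  using assms
proof (induction k arbitrary: m h)
  case 0
  then show ?case
    unfolding ray_integral_def[abs_def] Ck_on.simps
    by (intro integral_continuous_on_param continuous_on_ray)
next
  case (Suc k)
  then have "Ck_on (Suc 0) (ball a R) h"
    using Ck_on_imp_continuous_on[of k] by simp blast
  from has_derivative_ray_integral[OF this] show ?case
    by (rule Ck_on_SucI[OF open_ball]) (use Suc in auto)
qed

text \<open>\<open>F x - F a\<close> is the integral of the derivative of \<open>F\<close> along the
  segment from \<open>a\<close> to \<open>x\<close>. Expanding \<open>x - a\<close> in
  \<open>Basis\<close> gives the sum, with \<open>G b\<close> the average of the partial derivative
  along \<open>b\<close>.\<close>

lemma hadamard: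
  fixes a :: "'a::euclidean_space" and F :: "'a \<Rightarrow> real"
  assumes "smooth_on (ball a R) F"
  obtains G where "\<And>b. smooth_on (ball a R) (G b)" "\<And>b. G b a = frechet_derivative F (at a) b"
    "\<And>x. x \<in> ball a R \<Longrightarrow> F x = F a + (\<Sum>b\<in>Basis. ((x - a) \<bullet> b) * G b x)"
proof
  let ?F' = "\<lambda>x. frechet_derivative F (at x)"
  let ?G = "\<lambda>b. ray_integral a 0 (\<lambda>x. ?F' x b)"
  show "smooth_on (ball a R) (?G b)" for b
    using smooth_on_frechet_derivative[OF assms] by (simp add: smooth_on_def Ck_on_ray_integral)
  show "?G b a = ?F' a b" for b
    by (simp add: ray_integral_def)
  fix x assume x: "x \<in> ball a R"
  let ?y = "\<lambda>t. a + t *\<^sub>R (x - a)"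
  have y: "?y t \<in> ball a R" if "t \<in> {0..1}" for t
    using ray_in_ball[OF x that] .
  have int: "(\<lambda>t. ?F' (?y t) b) integrable_on {0..1}" for b
  proof -
    have "continuous_on (ball a R) (\<lambda>y. ?F' y b)"
      by (rule Ck_on_imp_continuous_on[OF smooth_on_imp_Ck_on[OF smooth_on_frechet_derivative[OF assms]]])
    moreover have "continuous_on {0..1} ?y"
      by (intro continuous_intros)
    ultimately have "continuous_on {0..1} (\<lambda>t. ?F' (?y t) b)"
      by (rule continuous_on_compose2) (rule image_subsetI[OF y])
    then show ?thesis
      by (rule integrable_continuous_interval)
  qed
  have expand: "?F' (?y t) (x - a) = (\<Sum>b\<in>Basis. ((x - a) \<bullet> b) * ?F' (?y t) b)" if "t \<in> {0..1}" for t
  proof -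
    have lin: "linear (?F' (?y t))"
      using has_derivative_linear[OF smooth_on_has_derivative[OF assms y[OF that]]] .
    have "?F' (?y t) (\<Sum>b\<in>Basis. ((x - a) \<bullet> b) *\<^sub>R b) = (\<Sum>b\<in>Basis. ((x - a) \<bullet> b) * ?F' (?y t) b)"
      by (simp add: linear_sum[OF lin] linear_cmul[OF lin])
    then show ?thesis by (simp only: euclidean_representation)
  qed
  have "((\<lambda>t. F (?y t)) has_vector_derivative ?F' (?y t) (x - a)) (at t within {0..1})"
    if "t \<in> {0..1}" for t
  proof -
    have F': "(F has_derivative ?F' (?y t)) (at (?y t))"
      by (rule smooth_on_has_derivative[OF assms y[OF that]])
    have "(?y has_derivative (\<lambda>s. s *\<^sub>R (x - a))) (at t within {0..1})"
      by (auto intro!: derivative_eq_intros)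
    from has_derivative_compose[OF this F'] show ?thesis
      by (simp add: has_vector_derivative_def linear_cmul[OF has_derivative_linear[OF F']])
  qed
  then have "((\<lambda>t. ?F' (?y t) (x - a)) has_integral F (?y 1) - F (?y 0)) {0..1}"
    by (intro fundamental_theorem_of_calculus) auto
  then have "F x - F a = integral {0..1} (\<lambda>t. ?F' (?y t) (x - a))"
    by (simp add: integral_unique)
  also have "\<dots> = integral {0..1} (\<lambda>t. \<Sum>b\<in>Basis. ((x - a) \<bullet> b) * ?F' (?y t) b)"
    by (rule integral_cong) (rule expand)
  also have "\<dots> = (\<Sum>b\<in>Basis. integral {0..1} (\<lambda>t. ((x - a) \<bullet> b) * ?F' (?y t) b))"
    by (intro integral_sum integrable_on_mult_right int) auto
  finally show "F x = F a + (\<Sum>b\<in>Basis. ((x - a) \<bullet> b) * ?G b x)"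
    by (simp add: ray_integral_def)
qed

subsection \<open>Tangent spaces\<close>

lemma sum_fun_apply: "(\<Sum>i\<in>I. f i) x = (\<Sum>i\<in>I. f i x)"
  by (induction I rule: infinite_finite_induct) auto

lemma smooth_funsD:
  "f \<in> smooth_funs A \<Longrightarrow> (U, c) \<in> A \<Longrightarrow> smooth_on (c ` U) (\<lambda>x. f (inv_into U c x))"
  unfolding smooth_funs_def by (auto simp: comp_def)

lemma smooth_funsI:
  "(\<And>U c. (U, c) \<in> A \<Longrightarrow> smooth_on (c ` U) (\<lambda>x. f (inv_into U c x))) \<Longrightarrow> f \<in> smooth_funs A"
  unfolding smooth_funs_def by (auto simp: comp_def)

lemma subspace_tangent_space: "subspace (tangent_space A p)"
  unfolding subspace_def tangent_space_def by (auto simp: algebra_simps)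

locale smooth_manifold =
  fixes A :: "('m::t2_space, 'e::euclidean_space) chart set"
  assumes atlas: "smooth_atlas A"
begin

section \<open>Charts and the algebra of smooth functions\<close>

lemma chart:
  assumes "(U, c) \<in> A"
  shows open_chart: "open U" and open_chart_image: "open (c ` U)"
    and homeomorphism_chart: "homeomorphism U (c ` U) c (inv_into U c)"
  using atlas assms unfolding smooth_atlas_def is_chart_def by auto

lemma inv_chart: "(U, c) \<in> A \<Longrightarrow> q \<in> U \<Longrightarrow> inv_into U c (c q) = q"
  using homeomorphism_chart homeomorphism_apply1 by blast

lemma open_image_chart: "(U, c) \<in> A \<Longrightarrow> open W \<Longrightarrow> open (c ` (U \<inter> W))"
  using homeomorphism_imp_open_map[OF homeomorphism_chart, of U c "U \<inter> W"]
  by (metis openin_open_Int openin_open_eq open_chart_image)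

lemma chart_at: obtains U c where "(U, c) \<in> A" "p \<in> U"
proof -
  have "p \<in> (\<Union>(U, c)\<in>A. U)"
    using atlas unfolding smooth_atlas_def by simp
  then show ?thesis using that by auto
qed

lemma smooth_transition:
  "(U, c) \<in> A \<Longrightarrow> (V, d) \<in> A \<Longrightarrow> smooth_on (d ` (V \<inter> U)) (\<lambda>x. c (inv_into V d x))"
  using atlas unfolding smooth_atlas_def by (fastforce simp: comp_def)

lemma smooth_funs_const: "(\<lambda>p. r) \<in> smooth_funs A"
  by (rule smooth_funsI) (simp add: smooth_on_const open_chart_image)

lemma smooth_funs_add: "f \<in> smooth_funs A \<Longrightarrow> h \<in> smooth_funs A \<Longrightarrow> f + h \<in> smooth_funs A"
  by (rule smooth_funsI) (simp add: smooth_on_add open_chart_image smooth_funsD)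

lemma smooth_funs_mult: "f \<in> smooth_funs A \<Longrightarrow> h \<in> smooth_funs A \<Longrightarrow> f * h \<in> smooth_funs A"
  by (rule smooth_funsI) (simp add: smooth_on_mult open_chart_image smooth_funsD)

lemma smooth_funs_scaleR: "f \<in> smooth_funs A \<Longrightarrow> r *\<^sub>R f \<in> smooth_funs A"
  by (rule smooth_funsI) (simp add: smooth_on_mult smooth_on_const open_chart_image smooth_funsD)

lemma smooth_funs_sum:
  "(\<And>i. i \<in> I \<Longrightarrow> f i \<in> smooth_funs A) \<Longrightarrow> (\<Sum>i\<in>I. f i) \<in> smooth_funs A"
  by (induction I rule: infinite_finite_induct)
    (auto simp: zero_fun_def smooth_funs_const intro: smooth_funs_add)

lemma tangent_sum:
  assumes "v \<in> tangent_space A p" "\<And>i. i \<in> I \<Longrightarrow> f i \<in> smooth_funs A"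
  shows "v (\<Sum>i\<in>I. f i) = (\<Sum>i\<in>I. v (f i))"
proof -
  \<comment> \<open>Homogeneity with factor 0 settles the empty sum.\<close>
  have "v (0 *\<^sub>R (\<lambda>p. 0)) = 0 * v (\<lambda>p. 0)"
    using assms(1) smooth_funs_const unfolding tangent_space_def by blast
  then have v0: "v 0 = 0" by simp
  show ?thesis using assms(2)
  proof (induction I rule: infinite_finite_induct)
    case (insert i I)
    then have "v (f i + (\<Sum>i\<in>I. f i)) = v (f i) + v (\<Sum>i\<in>I. f i)"
      using assms(1) smooth_funs_sum[of I f] unfolding tangent_space_def by blast
    then show ?case using insert by (metis insertCI sum.insert)
  qed (simp_all add: v0)
qed

section \<open>Extension by zero from a chart domain\<close>

definition chart_ext :: "'m set \<Rightarrow> ('m \<Rightarrow> 'e) \<Rightarrow> ('e \<Rightarrow> real) \<Rightarrow> 'm \<Rightarrow> real" where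
  "chart_ext U c h q = (if q \<in> U then h (c q) else 0)"

text \<open>Derivations act on global functions only, so local ones must be cut off and extended.
  The manifold is covered by the open sets \<open>U\<close>, where the extension is \<open>h\<close>
  in the chart, and the complement of the preimage of \<open>K\<close>, where it is 0.\<close>

lemma chart_ext_smooth:
  assumes Uc: "(U, c) \<in> A" and h: "smooth_on (c ` U) h"
    and K: "compact K" "K \<subseteq> c ` U" "\<And>x. x \<notin> K \<Longrightarrow> h x = 0"
  shows "chart_ext U c h \<in> smooth_funs A"
proof (rule smooth_funsI)
  fix V d assume Vd: "(V, d) \<in> A"
  let ?K = "inv_into U c ` K"
  have "compact ?K"
    using homeomorphism_chart[OF Uc] K(1,2)
    by (metis compact_continuous_image continuous_on_subset homeomorphism_def)
  \<comment> \<open>The Hausdorff property enters here: compact sets are closed.\<close>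
  then have "open (- ?K)" by (simp add: compact_imp_closed open_Compl)
  let ?f = "\<lambda>x. chart_ext U c h (inv_into V d x)"
  have "smooth_on (d ` (V \<inter> U)) ?f"
  proof (rule smooth_on_cong[OF open_image_chart[OF Vd open_chart[OF Uc]]])
    show "smooth_on (d ` (V \<inter> U)) (\<lambda>x. h (c (inv_into V d x)))"
      by (rule smooth_on_compose[OF open_image_chart[OF Vd open_chart[OF Uc]] open_chart_image[OF Uc]
            _ h smooth_transition[OF Uc Vd]])
        (auto simp: inv_chart[OF Vd])
  qed (auto simp: chart_ext_def inv_chart[OF Vd])
  moreover have "smooth_on (d ` (V \<inter> - ?K)) ?f"
  proof (rule smooth_on_cong[OF open_image_chart[OF Vd \<open>open (- ?K)\<close>]])
    show "smooth_on (d ` (V \<inter> - ?K)) (\<lambda>x. 0 :: real)"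
      by (rule smooth_on_const[OF open_image_chart[OF Vd \<open>open (- ?K)\<close>]])
    fix x assume "x \<in> d ` (V \<inter> - ?K)"
    then obtain q where q: "q \<in> V" "q \<notin> ?K" "x = d q" by auto
    then have "c q \<notin> K" if "q \<in> U"
      using inv_chart[OF Uc that] by force
    then show "0 = ?f x"
      using q K(3) by (auto simp: chart_ext_def inv_chart[OF Vd])
  qed
  ultimately have "smooth_on (d ` (V \<inter> U) \<union> d ` (V \<inter> - ?K)) ?f"
    by (intro smooth_on_Un open_image_chart[OF Vd] open_chart[OF Uc] \<open>open (- ?K)\<close>)
  moreover have "?K \<subseteq> U"
    using K(2) by (auto intro: inv_into_into)
  then have "V = (V \<inter> U) \<union> (V \<inter> - ?K)" by blast
  then have "d ` (V \<inter> U) \<union> d ` (V \<inter> - ?K) = d ` V" by (metis image_Un)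
  ultimately show "smooth_on (d ` V) ?f" by simp
qed

text \<open>The bump is supported in half the radius. Off the closed half ball the product vanishes
  whatever \<open>h\<close> is there, so it is smooth everywhere and zero off a compact subset of
  the chart image.\<close>

lemma cutoff_exists:
  assumes Uc: "(U, c) \<in> A" and p: "p \<in> U"
  obtains R and \<psi> :: "'e \<Rightarrow> real" where "0 < R" "ball (c p) R \<subseteq> c ` U" "smooth_on UNIV \<psi>" "\<psi> (c p) = 1"
    "\<And>x. x \<notin> ball (c p) R \<Longrightarrow> \<psi> x = 0"
    "\<And>h :: 'e \<Rightarrow> real. smooth_on (ball (c p) R) h \<Longrightarrow> chart_ext U c (\<lambda>x. \<psi> x * h x) \<in> smooth_funs A"
proof -
  obtain R where R: "0 < R" "ball (c p) R \<subseteq> c ` U"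
    using open_chart_image[OF Uc] p by (meson imageI open_contains_ball)
  have "0 < R / 2" using R(1) by simp
  then obtain \<psi> :: "'e \<Rightarrow> real" where \<psi>: "smooth_on UNIV \<psi>" "\<psi> (c p) = 1"
      "\<And>x. x \<notin> ball (c p) (R / 2) \<Longrightarrow> \<psi> x = 0"
    using smooth_bump_exists by blast
  show ?thesis
  proof (rule that[of R \<psi>])
    show "\<psi> x = 0" if "x \<notin> ball (c p) R" for x
      using \<psi>(3) that R(1) by force
    fix h :: "'e \<Rightarrow> real" assume h: "smooth_on (ball (c p) R) h"
    have "smooth_on (ball (c p) R \<union> - cball (c p) (R / 2)) (\<lambda>x. \<psi> x * h x)"
    proof (rule smooth_on_Un)
      show "smooth_on (ball (c p) R) (\<lambda>x. \<psi> x * h x)"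
        by (intro smooth_on_mult h smooth_on_subset[OF \<psi>(1)]) auto
      show "smooth_on (- cball (c p) (R / 2)) (\<lambda>x. \<psi> x * h x)"
        by (rule smooth_on_cong[OF _ _ smooth_on_const[of _ 0]]) (use \<psi>(3) in auto)
    qed auto
    then show "chart_ext U c (\<lambda>x. \<psi> x * h x) \<in> smooth_funs A"
    proof (intro chart_ext_smooth[OF Uc _ compact_cball[of "c p" "R / 2"]])
      show "cball (c p) (R / 2) \<subseteq> c ` U"
        using R by (auto simp: subset_eq)
      show "\<psi> x * h x = 0" if "x \<notin> cball (c p) (R / 2)" for x
        using \<psi>(3) that by simp
    qed (rule smooth_on_subset, assumption, use R in auto)
  qed (use R \<psi> in auto)
qed

section \<open>Coordinate vectors and the structure of tangent spaces\<close>

definition coord_vec :: "'m set \<Rightarrow> ('m \<Rightarrow> 'e) \<Rightarrow> 'm \<Rightarrow> 'e \<Rightarrow> 'm tvec" where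
  "coord_vec U c p u f = (if f \<in> smooth_funs A
     then frechet_derivative (\<lambda>x. f (inv_into U c x)) (at (c p)) u else 0)"

lemma smooth_fun_has_derivative:
  assumes "(U, c) \<in> A" "p \<in> U" "f \<in> smooth_funs A"
  shows "((\<lambda>x. f (inv_into U c x)) has_derivative (\<lambda>u. coord_vec U c p u f)) (at (c p))"
  using smooth_on_has_derivative[OF smooth_funsD[OF assms(3,1)]] assms(2,3)
  by (simp add: coord_vec_def)

lemma coord_vec_eqI:
  assumes "f \<in> smooth_funs A"
    "((\<lambda>x. f (inv_into U c x)) has_derivative F') (at (c p))"
  shows "coord_vec U c p u f = F' u"
  using frechet_derivative_at[OF assms(2)] assms(1) by (simp add: coord_vec_def)

lemma coord_vec_tangent:
  assumes "(U, c) \<in> A" "p \<in> U"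
  shows "coord_vec U c p u \<in> tangent_space A p"
proof -
  note D = smooth_fun_has_derivative[OF assms]
  have "coord_vec U c p u (f + h) = coord_vec U c p u f + coord_vec U c p u h"
    if "f \<in> smooth_funs A" "h \<in> smooth_funs A" for f h
    by (rule coord_vec_eqI[OF smooth_funs_add[OF that]])
      (use has_derivative_add[OF D[OF that(1)] D[OF that(2)]] in simp)
  moreover have "coord_vec U c p u (r *\<^sub>R f) = r * coord_vec U c p u f"
    if "f \<in> smooth_funs A" for f r
    by (rule coord_vec_eqI[OF smooth_funs_scaleR[OF that]])
      (use has_derivative_mult_right[OF D[OF that], of r] in simp)
  moreover have "coord_vec U c p u (f * h) = f p * coord_vec U c p u h + h p * coord_vec U c p u f"
    if "f \<in> smooth_funs A" "h \<in> smooth_funs A" for f h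
    by (rule coord_vec_eqI[OF smooth_funs_mult[OF that]])
      (use has_derivative_mult[OF D[OF that(1)] D[OF that(2)]] in
        \<open>simp add: inv_chart[OF assms] mult.commute\<close>)
  ultimately show ?thesis
    by (auto simp: tangent_space_def coord_vec_def)
qed

lemma linear_coord_vec:
  assumes "(U, c) \<in> A" "p \<in> U"
  shows "linear (coord_vec U c p)"
proof (rule linearI)
  have lin: "linear (\<lambda>u. coord_vec U c p u f)" if "f \<in> smooth_funs A" for f
    by (rule has_derivative_linear[OF smooth_fun_has_derivative[OF assms that]])
  show "coord_vec U c p (u + w) = coord_vec U c p u + coord_vec U c p w" for u w
    using linear_add[OF lin, of _ u w] by (force simp: coord_vec_def fun_eq_iff)
  show "coord_vec U c p (r *\<^sub>R u) = r *\<^sub>R coord_vec U c p u" for r u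
    using linear_cmul[OF lin, of _ r u] by (force simp: coord_vec_def fun_eq_iff)
qed

text \<open>Coordinate vectors are told apart by the cut-off coordinate functions \<open>?x\<close>,
  whose derivative at \<open>c p\<close> along \<open>u\<close> is
  \<open>u \<bullet> b\<close>.\<close>

lemma inj_coord_vec:
  assumes Uc: "(U, c) \<in> A" and p: "p \<in> U"
  shows "inj (coord_vec U c p)"
proof (rule injI)
  fix u w assume eq: "coord_vec U c p u = coord_vec U c p w"
  obtain R \<psi> where R: "0 < R" "ball (c p) R \<subseteq> c ` U" "smooth_on UNIV \<psi>" "\<psi> (c p) = 1"
    and ext: "\<And>h :: 'e \<Rightarrow> real. smooth_on (ball (c p) R) h \<Longrightarrow> chart_ext U c (\<lambda>x. \<psi> x * h x) \<in> smooth_funs A"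
    using cutoff_exists[OF assms] by metis
  have "u \<bullet> b = w \<bullet> b" for b
  proof -
    let ?x = "chart_ext U c (\<lambda>x. \<psi> x * ((x - c p) \<bullet> b))"
    have x: "?x \<in> smooth_funs A"
      by (intro ext smooth_on_inner smooth_on_diff_const smooth_on_const) auto
    have "(\<psi> has_derivative frechet_derivative \<psi> (at (c p))) (at (c p))"
      using smooth_on_has_derivative[OF R(3)] by simp
    moreover have "((\<lambda>x. (x - c p) \<bullet> b) has_derivative (\<lambda>u. u \<bullet> b)) (at (c p))"
      by (auto intro!: derivative_eq_intros)
    \<comment> \<open>The derivative of \<psi> drops out because the coordinate vanishes at
      \<open>c p\<close>, where \<psi> is 1.\<close>
    ultimately have "((\<lambda>x. \<psi> x * ((x - c p) \<bullet> b)) has_derivative (\<lambda>u. u \<bullet> b)) (at (c p))"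
      using has_derivative_mult R(4) by fastforce
    then have "((\<lambda>x. ?x (inv_into U c x)) has_derivative (\<lambda>u. u \<bullet> b)) (at (c p))"
      by (rule has_derivative_transform_within_open[OF _ open_chart_image[OF Uc]])
        (auto simp: p chart_ext_def inv_chart[OF Uc])
    from coord_vec_eqI[OF x this] show ?thesis
      using eq by metis
  qed
  then show "u = w" by (metis euclidean_eqI)
qed

text \<open>If \<open>\<psi>\<close> is a cutoff with \<open>\<psi> = 1\<close> at \<open>p\<close>, Hadamard's lemma makes \<open>\<psi>\<^sup>2 (f - f p)\<close> a sum of
  products of a cut-off coordinate with a global smooth function, so \<open>v f\<close> depends only on the
  values of \<open>v\<close> on the cut-off coordinates.\<close>

lemma tangent_coord_vec:
  assumes Uc: "(U, c) \<in> A" and p: "p \<in> U" and v: "v \<in> tangent_space A p"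
  obtains u where "v = coord_vec U c p u"
proof -
  let ?a = "c p"
  obtain R \<psi> where R: "0 < R" "ball ?a R \<subseteq> c ` U" "smooth_on UNIV \<psi>" "\<psi> ?a = 1"
    and supp: "\<And>x. x \<notin> ball ?a R \<Longrightarrow> \<psi> x = 0"
    and ext: "\<And>h. smooth_on (ball ?a R) h \<Longrightarrow> chart_ext U c (\<lambda>x. \<psi> x * h x) \<in> smooth_funs A"
    using cutoff_exists[OF Uc p] by metis
  define E where "E h = chart_ext U c (\<lambda>x. \<psi> x * h x)" for h
  define x where "x b = E (\<lambda>x. (x - ?a) \<bullet> b)" for b
  \<comment> \<open>The cutoff is squared so that one factor goes to the coordinate and the other to
    \<open>G b\<close>, making both global smooth functions.\<close>
  define k where "k = E (\<lambda>x. 1) * E (\<lambda>x. 1)"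
  define u where "u = (\<Sum>b\<in>Basis. v (x b) *\<^sub>R b)"
  have E: "E h \<in> smooth_funs A" if "smooth_on (ball ?a R) h" for h
    using ext[OF that] by (simp add: E_def)
  have x: "x b \<in> smooth_funs A" for b
    unfolding x_def by (intro E smooth_on_inner smooth_on_diff_const smooth_on_const) auto
  have k: "k \<in> smooth_funs A"
    unfolding k_def by (intro smooth_funs_mult E smooth_on_const) auto
  have [simp]: "x b p = 0" "k p = 1" "E h p = h ?a" for b h
    using p R(4) by (simp_all add: x_def k_def E_def chart_ext_def)
  have add: "v (f + h) = v f + v h" and mult: "v (f * h) = f p * v h + h p * v f"
    if "f \<in> smooth_funs A" "h \<in> smooth_funs A" for f h
    using v that unfolding tangent_space_def by blast+
  have scale: "v (r *\<^sub>R f) = r * v f" if "f \<in> smooth_funs A" for f r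
    using v that unfolding tangent_space_def by blast
  have "v f = coord_vec U c p u f" if f: "f \<in> smooth_funs A" for f
  proof -
    let ?F = "\<lambda>x. f (inv_into U c x)"
    have F: "smooth_on (ball ?a R) ?F"
      by (rule smooth_on_subset[OF smooth_funsD[OF f Uc] R(2)])
    obtain G where G: "\<And>b. smooth_on (ball ?a R) (G b)"
      "\<And>b. G b ?a = frechet_derivative ?F (at ?a) b"
      "\<And>x. x \<in> ball ?a R \<Longrightarrow> ?F x = ?F ?a + (\<Sum>b\<in>Basis. ((x - ?a) \<bullet> b) * G b x)"
      using hadamard[OF F] by metis
    have "k * f = f p *\<^sub>R k + (\<Sum>b\<in>Basis. x b * E (G b))"
    proof
      fix q
      show "(k * f) q = (f p *\<^sub>R k + (\<Sum>b\<in>Basis. x b * E (G b))) q"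
      proof (cases "q \<in> U \<and> c q \<in> ball ?a R")
        case True
        have "f q = f p + (\<Sum>b\<in>Basis. ((c q - ?a) \<bullet> b) * G b (c q))"
          using G(3)[of "c q"] True by (simp add: inv_chart[OF Uc] p)
        then show ?thesis
          using True
          by (simp add: sum_fun_apply k_def x_def E_def chart_ext_def algebra_simps sum_distrib_left)
      next
        case False
        then have "E h q = 0" for h
          using supp by (auto simp: E_def chart_ext_def)
        then show ?thesis by (simp add: k_def x_def sum_fun_apply)
      qed
    qed
    \<comment> \<open>The values of \<open>v\<close> on \<open>E (G b)\<close> disappear from the
      product rule since \<open>x b p = 0\<close>.\<close>
    moreover have "v (f p *\<^sub>R k + (\<Sum>b\<in>Basis. x b * E (G b)))
        = f p * v k + (\<Sum>b\<in>Basis. G b ?a * v (x b))"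
      using x k E[OF G(1)]
      by (simp add: add scale smooth_funs_scaleR smooth_funs_sum smooth_funs_mult tangent_sum[OF v] mult)
    \<comment> \<open>As \<open>k p = 1\<close>, the product rule gives
      \<open>v (k * f) = v f + f p * v k\<close>, and the terms \<open>f p * v k\<close>
      cancel.\<close>
    ultimately have "v f = (\<Sum>b\<in>Basis. v (x b) * G b ?a)"
      using mult[OF k f] by (simp add: mult.commute)
    also have "\<dots> = coord_vec U c p u f"
      using f by (simp add: u_def linear_sum[OF linear_coord_vec[OF Uc p]] linear_cmul[OF linear_coord_vec[OF Uc p]]
          sum_fun_apply coord_vec_def G(2))
    finally show ?thesis .
  qed
  moreover have "v f = coord_vec U c p u f" if "f \<notin> smooth_funs A" for f
    using v that by (simp add: tangent_space_def coord_vec_def)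
  ultimately show ?thesis using that by blast
qed

text \<open>The field with constant coordinates \<open>u\<close> in a chart becomes global after a
  cutoff. Identities assumed for smooth vector fields thereby hold for single tangent
  vectors.\<close>

lemma extend_tangent:
  assumes v: "v \<in> tangent_space A p"
  obtains V where "smooth_vector_field A V" "V p = v"
proof -
  obtain U c where Uc: "(U, c) \<in> A" and p: "p \<in> U" by (rule chart_at)
  obtain u where u: "v = coord_vec U c p u"
    using tangent_coord_vec[OF Uc p v] by blast
  obtain R \<psi> where R: "0 < R" "ball (c p) R \<subseteq> c ` U" "smooth_on UNIV \<psi>" "\<psi> (c p) = 1"
    and ext: "\<And>h :: 'e \<Rightarrow> real. smooth_on (ball (c p) R) h \<Longrightarrow> chart_ext U c (\<lambda>x. \<psi> x * h x) \<in> smooth_funs A"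
    using cutoff_exists[OF Uc p] by metis
  define V where "V q = (if q \<in> U then \<psi> (c q) *\<^sub>R coord_vec U c q u else 0)" for q
  have "V q \<in> tangent_space A q" for q
    by (simp add: V_def coord_vec_tangent[OF Uc] subspace_scale[OF subspace_tangent_space]
        subspace_0[OF subspace_tangent_space])
  moreover have "(\<lambda>q. V q f) \<in> smooth_funs A" if f: "f \<in> smooth_funs A" for f
  proof -
    let ?h = "\<lambda>x. frechet_derivative (\<lambda>x. f (inv_into U c x)) (at x) u"
    have "(\<lambda>q. V q f) = chart_ext U c (\<lambda>x. \<psi> x * ?h x)"
      using f by (auto simp: V_def chart_ext_def coord_vec_def)
    moreover have "smooth_on (ball (c p) R) ?h"
      by (rule smooth_on_subset[OF smooth_on_frechet_derivative[OF smooth_funsD[OF f Uc]] R(2)])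
    ultimately show ?thesis using ext by simp
  qed
  ultimately show ?thesis
    using that[of V] p R(4) u by (simp add: smooth_vector_field_def V_def)
qed

end

context smooth_manifold
begin

subsection \<open>Gradients\<close>

context
  fixes g :: "'m \<Rightarrow> 'm tvec \<Rightarrow> 'm tvec \<Rightarrow> real"
  assumes g: "riemannian_metric A g"
begin

lemma metric_add_right:
  "v \<in> tangent_space A p \<Longrightarrow> w \<in> tangent_space A p \<Longrightarrow> w' \<in> tangent_space A p \<Longrightarrow>
    g p v (w + w') = g p v w + g p v w'"
  using g unfolding riemannian_metric_def linear_map_on_def by blast

lemma metric_scale_right:
  "v \<in> tangent_space A p \<Longrightarrow> w \<in> tangent_space A p \<Longrightarrow> g p v (r *\<^sub>R w) = r * g p v w"
  using g unfolding riemannian_metric_def linear_map_on_def by fastforce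

lemma metric_sym:
  "v \<in> tangent_space A p \<Longrightarrow> w \<in> tangent_space A p \<Longrightarrow> g p v w = g p w v"
  using g unfolding riemannian_metric_def by blast

lemma metric_pos: "v \<in> tangent_space A p \<Longrightarrow> v \<noteq> 0 \<Longrightarrow> 0 < g p v v"
  using g unfolding riemannian_metric_def by blast

lemma metric_add_left:
  "v \<in> tangent_space A p \<Longrightarrow> w \<in> tangent_space A p \<Longrightarrow> w' \<in> tangent_space A p \<Longrightarrow>
    g p (w + w') v = g p w v + g p w' v"
  by (simp add: metric_sym[of _ p v] metric_add_right subspace_add[OF subspace_tangent_space])

lemma metric_scale_left:
  "v \<in> tangent_space A p \<Longrightarrow> w \<in> tangent_space A p \<Longrightarrow> g p (r *\<^sub>R w) v = r * g p w v"
  by (simp add: metric_sym[of _ p v] metric_scale_right subspace_scale[OF subspace_tangent_space])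

text \<open>Nondegeneracy: testing against the difference \<open>?d\<close> contradicts
  positivity.\<close>

lemma metric_eqI:
  assumes "v \<in> tangent_space A p" "v' \<in> tangent_space A p"
    "\<And>w. w \<in> tangent_space A p \<Longrightarrow> g p v w = g p v' w"
  shows "v = v'"
proof (rule ccontr)
  let ?d = "v + (- 1) *\<^sub>R v'"
  have d: "?d \<in> tangent_space A p"
    using assms by (intro subspace_add subspace_scale subspace_tangent_space)
  assume "v \<noteq> v'"
  then have "?d \<noteq> 0" by auto
  then have "0 < g p ?d ?d" by (rule metric_pos[OF d])
  also have "g p ?d ?d = g p v ?d + (- 1) * g p v' ?d"
    using assms d by (simp only: metric_add_left metric_scale_left subspace_scale[OF subspace_tangent_space])
  also have "\<dots> = 0" using assms(3)[OF d] by simp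
  finally show False by simp
qed

text \<open>Riesz representation, carried over to \<open>'e\<close> by the linear isomorphism
  \<open>coord_vec U c p\<close>. Positivity makes the Gram map injective, hence surjective in
  finite dimension.\<close>

lemma riesz_tangent:
  assumes f: "f \<in> smooth_funs A"
  obtains v where "v \<in> tangent_space A p" "\<And>w. w \<in> tangent_space A p \<Longrightarrow> g p v w = w f"
proof -
  obtain U c where Uc: "(U, c) \<in> A" and p: "p \<in> U" by (rule chart_at)
  let ?D = "coord_vec U c p"
  have D: "?D u \<in> tangent_space A p" for u by (rule coord_vec_tangent[OF Uc p])
  note lin_D = linear_coord_vec[OF Uc p]
  have lin: "linear (\<lambda>u. g p (?D z) (?D u))" for z
    by (rule linearI) (simp_all add: linear_add[OF lin_D] linear_cmul[OF lin_D] metric_add_right metric_scale_right D)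
  \<comment> \<open>\<open>L\<close> is the Gram matrix of the metric in the chart, relating it to
    the Euclidean inner product.\<close>
  define L where "L z = (\<Sum>b\<in>Basis. g p (?D z) (?D b) *\<^sub>R b)" for z
  have L: "L z \<bullet> u = g p (?D z) (?D u)" for z u
  proof -
    have "g p (?D z) (?D (\<Sum>b\<in>Basis. (u \<bullet> b) *\<^sub>R b)) = (\<Sum>b\<in>Basis. (u \<bullet> b) * g p (?D z) (?D b))"
      by (simp only: linear_sum[OF lin] linear_cmul[OF lin] real_scaleR_def)
    then have "g p (?D z) (?D u) = (\<Sum>b\<in>Basis. (u \<bullet> b) * g p (?D z) (?D b))"
      by (simp only: euclidean_representation)
    then show ?thesis
      unfolding L_def inner_sum_left inner_scaleR_left by (simp add: inner_commute[of u] mult.commute)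
  qed
  have "linear L"
    unfolding L_def
    by (rule linearI) (simp_all add: linear_add[OF lin_D] linear_cmul[OF lin_D] metric_add_left metric_scale_left D
        scaleR_left_distrib sum.distrib scaleR_sum_right)
  moreover have "inj L"
  proof (rule linear_injective_0[OF \<open>linear L\<close>, THEN iffD2], intro allI impI)
    fix z assume "L z = 0"
    then have "?D z = 0" using L[of z z] metric_pos[OF D, of z] by force
    then show "z = 0" using inj_coord_vec[OF Uc p] linear_0[OF lin_D] by (metis injD)
  qed
  ultimately have "surj L" by (rule linear_inj_imp_surj)
  \<comment> \<open>The right-hand side is the Euclidean gradient of \<open>f\<close> in the
    chart.\<close>
  then obtain z where z: "L z = (\<Sum>b\<in>Basis. ?D b f *\<^sub>R b)" by (metis surjD)
  have linf: "linear (\<lambda>u. ?D u f)"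
    by (rule linearI) (simp_all add: linear_add[OF lin_D] linear_cmul[OF lin_D])
  have "g p (?D z) (?D u) = ?D u f" for u
  proof -
    have "?D (\<Sum>b\<in>Basis. (u \<bullet> b) *\<^sub>R b) f = (\<Sum>b\<in>Basis. (u \<bullet> b) * ?D b f)"
      by (simp only: linear_sum[OF linf] linear_cmul[OF linf] real_scaleR_def)
    then have "?D u f = (\<Sum>b\<in>Basis. (u \<bullet> b) * ?D b f)"
      by (simp only: euclidean_representation)
    then show ?thesis
      using L[of z u] unfolding z inner_sum_left inner_scaleR_left
      by (simp add: inner_commute[of u] mult.commute)
  qed
  then show ?thesis
    using that[OF D, of z] tangent_coord_vec[OF Uc p] by metis
qed

text \<open>Existence by \<open>riesz_tangent\<close> and uniqueness by \<open>metric_eqI\<close>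
  justify the \<open>THE\<close> in \<open>gradient\<close>.\<close>

lemma
  assumes "f \<in> smooth_funs A"
  shows gradient_tangent: "gradient A g f p \<in> tangent_space A p"
    and metric_gradient: "w \<in> tangent_space A p \<Longrightarrow> g p (gradient A g f p) w = w f"
proof -
  obtain v where v: "v \<in> tangent_space A p" "\<And>w. w \<in> tangent_space A p \<Longrightarrow> g p v w = w f"
    using riesz_tangent[OF assms] by blast
  then have "gradient A g f p = v"
    unfolding gradient_def by (intro the_equality) (auto intro: metric_eqI)
  then show "gradient A g f p \<in> tangent_space A p"
    and "w \<in> tangent_space A p \<Longrightarrow> g p (gradient A g f p) w = w f"
    using v by auto
qed

end

end

subsection \<open>Weak contact metric structures\<close>

locale weak_contact_metric_manifold = smooth_manifold A
  for A :: "('m::t2_space, 'e::euclidean_space) chart set" +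
  fixes \<phi> Q :: "'m \<Rightarrow> 'm tvec \<Rightarrow> 'm tvec"
    and \<xi> :: "'m \<Rightarrow> 'm tvec"
    and \<eta> :: "'m \<Rightarrow> 'm tvec \<Rightarrow> real"
    and g :: "'m \<Rightarrow> 'm tvec \<Rightarrow> 'm tvec \<Rightarrow> real"
    and \<nu> :: real
  assumes contact_metric: "weak_contact_metric_structure A \<phi> Q \<xi> \<eta> g"
    and Q_xi: "Q p (\<xi> p) = \<nu> *\<^sub>R \<xi> p"
begin

section \<open>Pointwise identities of the structure tensors\<close>

abbreviation T :: "'m \<Rightarrow> 'm tvec set" where "T \<equiv> tangent_space A"

lemma almost_contact: "weak_almost_contact_structure A \<phi> Q \<xi> \<eta>"
  and metric: "riemannian_metric A g"
  using contact_metric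
  unfolding weak_contact_metric_structure_def weak_almost_contact_metric_structure_def by auto

lemma xi_smooth: "smooth_vector_field A \<xi>"
  and eta_one_form: "one_form A \<eta>"
  and phi_tensor: "tensor_field_11 A \<phi>"
  and Q_tensor: "tensor_field_11 A Q"
  and Q_bij: "bij_betw (Q p) (T p) (T p)"
  and eta_xi: "\<eta> p (\<xi> p) = 1"
  using almost_contact unfolding weak_almost_contact_structure_def by auto

lemma xi_T: "\<xi> p \<in> T p"
  using xi_smooth unfolding smooth_vector_field_def by blast

lemma phi_T: "v \<in> T p \<Longrightarrow> \<phi> p v \<in> T p" and Q_T: "v \<in> T p \<Longrightarrow> Q p v \<in> T p"
  using phi_tensor Q_tensor unfolding tensor_field_11_def by blast+

lemmas T_add = subspace_add[OF subspace_tangent_space]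
lemmas T_scale = subspace_scale[OF subspace_tangent_space]
lemmas T_simps = T_add T_scale xi_T phi_T Q_T
lemmas metric_simps = metric_add_left[OF metric] metric_add_right[OF metric]
  metric_scale_left[OF metric] metric_scale_right[OF metric]

lemma eta_add: "v \<in> T p \<Longrightarrow> w \<in> T p \<Longrightarrow> \<eta> p (v + w) = \<eta> p v + \<eta> p w"
  and eta_scale: "v \<in> T p \<Longrightarrow> \<eta> p (r *\<^sub>R v) = r * \<eta> p v"
  using eta_one_form unfolding one_form_def linear_map_on_def by simp_all

lemma phi_add: "v \<in> T p \<Longrightarrow> w \<in> T p \<Longrightarrow> \<phi> p (v + w) = \<phi> p v + \<phi> p w"
  and phi_scale: "v \<in> T p \<Longrightarrow> \<phi> p (r *\<^sub>R v) = r *\<^sub>R \<phi> p v"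
  and Q_scale: "v \<in> T p \<Longrightarrow> Q p (r *\<^sub>R v) = r *\<^sub>R Q p v"
  using phi_tensor Q_tensor unfolding tensor_field_11_def linear_map_on_def by blast+

lemma phi_phi: "v \<in> T p \<Longrightarrow> \<phi> p (\<phi> p v) = (- 1) *\<^sub>R Q p v + (\<nu> * \<eta> p v) *\<^sub>R \<xi> p"
  using almost_contact Q_xi unfolding weak_almost_contact_structure_def
  by (simp add: mult.commute)

text \<open>Compatibility is assumed for vector fields; \<open>extend_tangent\<close> brings it to
  single vectors.\<close>

lemma metric_phi_phi:
  assumes "v \<in> T p" "w \<in> T p"
  shows "g p (\<phi> p v) (\<phi> p w) = g p v (Q p w) - \<eta> p v * \<eta> p (Q p w)"
proof -
  obtain V W where "smooth_vector_field A V" "V p = v" "smooth_vector_field A W" "W p = w"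
    using assms extend_tangent by metis
  then show ?thesis
    using contact_metric
    unfolding weak_contact_metric_structure_def weak_almost_contact_metric_structure_def by blast
qed

lemma ext_deriv_eta:
  "smooth_vector_field A X \<Longrightarrow> smooth_vector_field A Y \<Longrightarrow> ext_deriv \<eta> X Y p = g p (X p) (\<phi> p (Y p))"
  using contact_metric unfolding weak_contact_metric_structure_def by blast

text \<open>For any extension \<open>V\<close> of \<open>v\<close> this is d\<eta>(V, V), which
  vanishes by antisymmetry.\<close>

lemma metric_phi_self:
  assumes "v \<in> T p" shows "g p v (\<phi> p v) = 0"
proof -
  obtain V where V: "smooth_vector_field A V" "V p = v"
    using assms extend_tangent by metis
  have "lie_bracket V V p = 0"
    by (simp add: lie_bracket_def fun_eq_iff)
  moreover have "\<eta> p 0 = 0"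
    using eta_scale[OF xi_T, of p 0] by simp
  ultimately show ?thesis
    using ext_deriv_eta[OF V(1,1), of p] V(2) by (simp add: ext_deriv_def)
qed

text \<open>Polarisation of \<open>metric_phi_self\<close>.\<close>

lemma metric_phi_skew:
  assumes "v \<in> T p" "w \<in> T p" shows "g p v (\<phi> p w) = - g p (\<phi> p v) w"
proof -
  have "0 = g p (v + w) (\<phi> p (v + w))"
    using assms by (simp add: metric_phi_self T_simps)
  also have "\<dots> = g p v (\<phi> p w) + g p w (\<phi> p v)"
    using assms by (simp add: phi_add metric_simps metric_phi_self T_simps)
  finally show ?thesis
    using metric_sym[OF metric assms(2) phi_T[OF assms(1)]] by simp
qed

lemma zero_T: "0 \<in> T p"
  by (rule subspace_0[OF subspace_tangent_space])

text \<open>The formula for the square of \<phi> sends \<xi> to 0, so by skew-symmetry \<phi>\<xi>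
  has length 0.\<close>

lemma phi_xi: "\<phi> p (\<xi> p) = 0"
proof -
  have "\<phi> p (\<phi> p (\<xi> p)) = 0 *\<^sub>R \<xi> p"
    using phi_phi[OF xi_T] by (simp add: Q_xi eta_xi)
  then have "g p (\<xi> p) (\<phi> p (\<phi> p (\<xi> p))) = 0"
    using metric_scale_right[OF metric xi_T xi_T, of p 0] by simp
  then have "g p (\<phi> p (\<xi> p)) (\<phi> p (\<xi> p)) = 0"
    using metric_phi_skew[OF xi_T phi_T[OF xi_T]] by simp
  then show ?thesis
    using metric_pos[OF metric phi_T[OF xi_T]] by force
qed

lemma metric_zero_left: "w \<in> T p \<Longrightarrow> g p 0 w = 0"
  using metric_scale_left[OF metric _ xi_T, of w p 0] by simp

text \<open>Compatibility at \<xi> and \<open>v\<close> has left side 0 by \<open>phi_xi\<close>,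
  which gives the claim for \<open>Q p v\<close>; \<open>Q p\<close> is onto.\<close>

lemma metric_xi:
  assumes "w \<in> T p" shows "g p (\<xi> p) w = \<eta> p w"
proof -
  obtain v where v: "v \<in> T p" "w = Q p v"
    using Q_bij[of p] assms unfolding bij_betw_def by auto
  show ?thesis
    using metric_phi_phi[OF xi_T v(1)] v by (simp add: phi_xi eta_xi metric_zero_left phi_T)
qed

lemma eta_phi: "v \<in> T p \<Longrightarrow> \<eta> p (\<phi> p v) = 0"
  using metric_phi_skew[OF xi_T, of v p] by (simp add: phi_xi metric_xi metric_zero_left phi_T)

text \<open>Apply \<eta> to the formula for the square of \<phi>; the left side vanishes by
  \<open>eta_phi\<close>.\<close>

lemma eta_Q:
  assumes v: "v \<in> T p" shows "\<eta> p (Q p v) = \<nu> * \<eta> p v"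
proof -
  have "\<eta> p (\<phi> p (\<phi> p v)) = 0"
    by (rule eta_phi[OF phi_T[OF v]])
  then show ?thesis
    by (simp only: phi_phi eta_add eta_scale T_simps eta_xi v)
qed

text \<open>If \<phi> kills \<open>v\<close>, so does its square, which gives Qv = \<eta>(v) Q\<xi>;
  now cancel the injective \<open>Q p\<close>.\<close>

lemma phi_eq_0:
  assumes v: "v \<in> T p" "\<phi> p v = 0" shows "v = \<eta> p v *\<^sub>R \<xi> p"
proof -
  have "\<phi> p (\<phi> p v) = 0"
    using v(2) phi_scale[OF zero_T, of p 0] by simp
  then have "Q p v = Q p (\<eta> p v *\<^sub>R \<xi> p)"
    using phi_phi[OF v(1)] by (simp add: Q_scale xi_T Q_xi mult.commute)
  then show ?thesis
    using Q_bij[of p] v(1) T_scale[OF xi_T] unfolding bij_betw_def by (metis inj_onD)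
qed

text \<open>Cartan's formula: the Lie derivative exceeds 2 d\<eta>(X, Y) by exactly
  Y(\<eta>(X)).\<close>

lemma lie_deriv_eta:
  assumes "smooth_vector_field A X" "smooth_vector_field A Y"
  shows "lie_deriv_form X \<eta> Y p = 2 * g p (X p) (\<phi> p (Y p)) + Y p (\<lambda>q. \<eta> q (X q))"
  using ext_deriv_eta[OF assms, of p] unfolding ext_deriv_def lie_deriv_form_def by simp

section \<open>Contact vector fields and their potentials\<close>

context
  fixes X assumes X: "smooth_vector_field A X"
begin

lemma X_T: "X p \<in> T p"
  using X unfolding smooth_vector_field_def by blast

lemma eta_X_smooth: "(\<lambda>p. \<eta> p (X p)) \<in> smooth_funs A"
  using eta_one_form X unfolding one_form_def by blast

abbreviation "grad \<equiv> gradient A g"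
lemmas gradient_T = gradient_tangent[OF metric]

text \<open>The field Z of the introduction: the metric dual of the Lie derivative of \<eta> along
  \<open>X\<close>, as \<open>lie_deriv_eta_defect\<close> shows.\<close>

definition defect :: "'m \<Rightarrow> 'm tvec" where
  "defect p = grad (\<lambda>p. \<eta> p (X p)) p + (- 2) *\<^sub>R \<phi> p (X p)"

lemma defect_T: "defect p \<in> T p"
  unfolding defect_def by (intro T_add T_scale gradient_T eta_X_smooth phi_T X_T)

lemma lie_deriv_eta_defect:
  assumes "smooth_vector_field A Y"
  shows "lie_deriv_form X \<eta> Y p = g p (defect p) (Y p)"
proof -
  have Y: "Y p \<in> T p"
    using assms unfolding smooth_vector_field_def by blast
  show ?thesis
    unfolding lie_deriv_eta[OF X assms] defect_def
    by (simp add: metric_simps Y gradient_T eta_X_smooth T_simps X_T metric_gradient[OF metric eta_X_smooth Y]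
        metric_phi_skew del: scaleR_minus_left)
qed

text \<open>By \<open>metric_xi\<close> the form \<sigma>\<eta> is dual to \<sigma>\<xi>, and dual
  vectors are unique. Testing on all tangent vectors uses \<open>extend_tangent\<close>.\<close>

lemma lie_deriv_eq_iff: "lie_deriv_eq A \<eta> X \<sigma> \<longleftrightarrow> (\<forall>p. defect p = \<sigma> p *\<^sub>R \<xi> p)"
proof
  assume L: "lie_deriv_eq A \<eta> X \<sigma>"
  show "\<forall>p. defect p = \<sigma> p *\<^sub>R \<xi> p"
  proof
    fix p
    show "defect p = \<sigma> p *\<^sub>R \<xi> p"
    proof (rule metric_eqI[OF metric defect_T T_scale[OF xi_T]])
      fix w assume w: "w \<in> T p"
      then obtain W where W: "smooth_vector_field A W" "W p = w"
        using extend_tangent by metis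
      then have "g p (defect p) w = \<sigma> p * \<eta> p w"
        using L lie_deriv_eta_defect[OF W(1), of p] unfolding lie_deriv_eq_def by metis
      then show "g p (defect p) w = g p (\<sigma> p *\<^sub>R \<xi> p) w"
        using w by (simp add: metric_simps xi_T metric_xi)
    qed
  qed
next
  assume "\<forall>p. defect p = \<sigma> p *\<^sub>R \<xi> p"
  moreover have "Y p \<in> T p" if "smooth_vector_field A Y" for Y p
    using that unfolding smooth_vector_field_def by blast
  ultimately show "lie_deriv_eq A \<eta> X \<sigma>"
    by (simp add: lie_deriv_eq_def lie_deriv_eta_defect metric_simps xi_T metric_xi)
qed

lemma eta_gradient: "f \<in> smooth_funs A \<Longrightarrow> \<eta> p (grad f p) = \<xi> p f"
  using metric_xi[OF gradient_T] metric_sym[OF metric xi_T gradient_T]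
    metric_gradient[OF metric _ xi_T] by metis

lemma eta_defect: "\<eta> p (defect p) = \<xi> p (\<lambda>p. \<eta> p (X p))"
  unfolding defect_def
  by (simp add: eta_add eta_scale eta_phi eta_gradient gradient_T eta_X_smooth T_simps X_T del: scaleR_minus_left)

text \<open>The kernel of \<phi> is the line of \<xi>, and \<open>eta_defect\<close> computes the
  coefficient.\<close>

lemma phi_defect_eq_0_iff:
  "\<phi> p (defect p) = 0 \<longleftrightarrow> defect p = \<xi> p (\<lambda>p. \<eta> p (X p)) *\<^sub>R \<xi> p"
proof
  assume "\<phi> p (defect p) = 0"
  from phi_eq_0[OF defect_T this] show "defect p = \<xi> p (\<lambda>p. \<eta> p (X p)) *\<^sub>R \<xi> p"
    by (simp add: eta_defect)
next
  assume "defect p = \<xi> p (\<lambda>p. \<eta> p (X p)) *\<^sub>R \<xi> p"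
  then show "\<phi> p (defect p) = 0"
    by (simp add: phi_scale xi_T phi_xi)
qed

text \<open>The bracket is the difference of the two sides of the asserted equation for the
  potential \<eta>(X), so that equation says exactly that \<phi> kills
  \<open>defect\<close>.\<close>

lemma phi_defect:
  "\<phi> p (defect p) = 2 *\<^sub>R (Q p (X p) -
    (- (1 / 2) *\<^sub>R \<phi> p (grad (\<lambda>p. \<eta> p (X p)) p) + (\<nu> * \<eta> p (X p)) *\<^sub>R \<xi> p))"
proof -
  have "\<phi> p (defect p) = \<phi> p (grad (\<lambda>p. \<eta> p (X p)) p) + (- 2) *\<^sub>R \<phi> p (\<phi> p (X p))"
    unfolding defect_def
    by (simp only: phi_add phi_scale gradient_T[OF eta_X_smooth] T_scale phi_T X_T)
  then show ?thesis
    by (simp add: phi_phi X_T algebra_simps)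
qed

text \<open>Applying \<eta> to \<open>eq\<close> removes the gradient term by \<open>eta_phi\<close>
  and leaves \<nu>\<eta>(X) = \<nu>f.\<close>

lemma potential_eq:
  assumes f: "f \<in> smooth_funs A"
    and eq: "\<And>p. Q p (X p) = - (1 / 2) *\<^sub>R \<phi> p (grad f p) + (\<nu> * f p) *\<^sub>R \<xi> p"
  shows "f = (\<lambda>p. \<eta> p (X p))"
proof
  fix p
  have "\<nu> * \<eta> p (X p) = \<eta> p (Q p (X p))"
    by (simp add: eta_Q X_T)
  also have "\<dots> = \<nu> * f p"
    unfolding eq using f
    by (simp add: eta_add eta_scale eta_phi eta_xi gradient_T T_simps del: scaleR_minus_left)
  \<comment> \<open>The structure provides some positive eigenvalue \<nu>' at \<xi>; applying \<eta>
    identifies it with \<nu>.\<close>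
  moreover have "\<nu> \<noteq> 0"
  proof -
    obtain \<nu>' where "\<nu>' > 0" "\<And>p. Q p (\<xi> p) = \<nu>' *\<^sub>R \<xi> p"
      using almost_contact unfolding weak_almost_contact_structure_def by auto
    then have "\<eta> p (\<nu> *\<^sub>R \<xi> p) = \<eta> p (\<nu>' *\<^sub>R \<xi> p)" by (metis Q_xi)
    with \<open>\<nu>' > 0\<close> show ?thesis by (simp add: eta_scale xi_T eta_xi)
  qed
  ultimately show "f p = \<eta> p (X p)" by simp
qed

lemma weak_contact_iff:
  "weak_contact_vector_field A \<eta> X \<longleftrightarrow>
    (\<forall>p. defect p = \<xi> p (\<lambda>p. \<eta> p (X p)) *\<^sub>R \<xi> p)"
proof
  assume "weak_contact_vector_field A \<eta> X"
  then obtain \<sigma> where "\<forall>p. defect p = \<sigma> p *\<^sub>R \<xi> p"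
    unfolding weak_contact_vector_field_def lie_deriv_eq_iff by blast
  then have "\<phi> p (defect p) = 0" for p
    by (simp add: phi_scale xi_T phi_xi)
  then show "\<forall>p. defect p = \<xi> p (\<lambda>p. \<eta> p (X p)) *\<^sub>R \<xi> p"
    by (simp add: phi_defect_eq_0_iff)
next
  \<comment> \<open>This function is the witness for \<sigma>.\<close>
  have "(\<lambda>p. \<xi> p (\<lambda>p. \<eta> p (X p))) \<in> smooth_funs A"
    using xi_smooth eta_X_smooth unfolding smooth_vector_field_def by blast
  moreover assume "\<forall>p. defect p = \<xi> p (\<lambda>p. \<eta> p (X p)) *\<^sub>R \<xi> p"
  ultimately show "weak_contact_vector_field A \<eta> X"
    using X lie_deriv_eq_iff unfolding weak_contact_vector_field_def by blast
qed

lemma weak_contact_iff_potential: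
  "weak_contact_vector_field A \<eta> X \<longleftrightarrow>
    (\<exists>f\<in>smooth_funs A. \<forall>p. Q p (X p) = - (1 / 2) *\<^sub>R \<phi> p (grad f p) + (\<nu> * f p) *\<^sub>R \<xi> p)"
  (is "_ \<longleftrightarrow> (\<exists>f\<in>_. ?P f)")
proof -
  have "weak_contact_vector_field A \<eta> X \<longleftrightarrow> (\<forall>p. \<phi> p (defect p) = 0)"
    by (simp add: weak_contact_iff phi_defect_eq_0_iff)
  also have "\<dots> \<longleftrightarrow> ?P (\<lambda>p. \<eta> p (X p))"
    by (simp only: phi_defect) simp
  \<comment> \<open>\<eta>(X) serves as witness, and by \<open>potential_eq\<close> it is the only
    candidate.\<close>
  also have "\<dots> \<longleftrightarrow> (\<exists>f\<in>smooth_funs A. ?P f)"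
    using eta_X_smooth potential_eq by blast
  finally show ?thesis .
qed

text \<open>Since \<open>f\<close> equals \<eta>(X), \<open>defect\<close> is \<xi>(f)\<xi>;
  strictness says that it is 0, and \<xi> vanishes nowhere.\<close>

lemma strict_iff_potential:
  assumes "weak_contact_vector_field A \<eta> X" and f: "f \<in> smooth_funs A"
    and eq: "\<And>p. Q p (X p) = - (1 / 2) *\<^sub>R \<phi> p (grad f p) + (\<nu> * f p) *\<^sub>R \<xi> p"
  shows "strict_weak_contact_vector_field A \<eta> X \<longleftrightarrow> (\<forall>p. \<xi> p f = 0)"
proof -
  have "defect p = \<xi> p f *\<^sub>R \<xi> p" for p
    using assms(1) unfolding weak_contact_iff potential_eq[OF f eq] by blast
  moreover have "\<xi> p \<noteq> 0" for p
    using eta_xi[of p] eta_scale[OF xi_T, of p 0] by auto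
  ultimately show ?thesis
    using X by (simp add: strict_weak_contact_vector_field_def lie_deriv_eq_iff)
qed

end

end

theorem theorem6p1:
  fixes A :: "('m::{t2_space, second_countable_topology}, 'e::euclidean_space) chart set"
    and \<phi> Q :: "'m \<Rightarrow> 'm tvec \<Rightarrow> 'm tvec"
    and \<xi> X :: "'m \<Rightarrow> 'm tvec"
    and \<eta> :: "'m \<Rightarrow> 'm tvec \<Rightarrow> real"
    and g :: "'m \<Rightarrow> 'm tvec \<Rightarrow> 'm tvec \<Rightarrow> real"
    and \<nu> :: real and n :: nat
  assumes "smooth_atlas A" and "DIM('e) = 2 * n + 1"
    and "weak_contact_metric_structure A \<phi> Q \<xi> \<eta> g"
    and "\<And>p. Q p (\<xi> p) = \<nu> *\<^sub>R \<xi> p"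
    and "smooth_vector_field A X"
  shows "(weak_contact_vector_field A \<eta> X \<longleftrightarrow>
            (\<exists>f\<in>smooth_funs A. \<forall>p. Q p (X p) =
               - (1 / 2) *\<^sub>R \<phi> p (gradient A g f p) + (\<nu> * f p) *\<^sub>R \<xi> p)) \<and>
         (weak_contact_vector_field A \<eta> X \<longrightarrow>
            (\<forall>f\<in>smooth_funs A.
               (\<forall>p. Q p (X p) = - (1 / 2) *\<^sub>R \<phi> p (gradient A g f p) + (\<nu> * f p) *\<^sub>R \<xi> p) \<longrightarrow>
               (strict_weak_contact_vector_field A \<eta> X \<longleftrightarrow> (\<forall>p. \<xi> p f = 0))))"
proof -
  interpret weak_contact_metric_manifold A \<phi> Q \<xi> \<eta> g \<nu>
    using assms(1,3,4) by unfold_locales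
  show ?thesis
    using weak_contact_iff_potential[OF assms(5)] strict_iff_potential[OF assms(5)] by blast
qed

end
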